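(* Let $k,q\ge1$, $p\ge0$, $T\ge q$ be integers and let $\boldsymbol\theta(L)=1+\theta_1L+\cdots+\theta_qL^q=\prod_{l=1}^q(1-\lambda_lL)$ be a real polynomial with $\lambda_1,\dots,\lambda_q\in\mathbb C\setminus\{0\}$ pairwise distinct. Let $\{i_1,\dots,i_r\}\subset\{1,\dots,q\}$ be such that $\{\lambda_{i_1},\dots,\lambda_{i_r}\}$ is closed under complex conjugation, and let $IR=IR_{i_1\cdots i_r}$ be the corresponding root inversion map, defined near $\boldsymbol\theta$ in coefficient space $\mathbb R^q$, with Jacobian matrix $J[IR]$. If $\boldsymbol\theta$ is fixed under $IR$, i.e. $IR(\boldsymbol\theta)=\boldsymbol\theta$, then $$J[IR]^2(\boldsymbol\theta)=I_q,$$ so that $J[IR](\boldsymbol\theta)$ has only eigenvalues $1$ or $-1$. Moreover, for any data $X_1,\dots,X_{T+p}$ for which $\bar{\mathscr L}$ is defined at $\boldsymbol\theta$, $$\nabla\bar{\mathscr L}(\boldsymbol\theta)\,J[IR](\boldsymbol\theta)=\nabla\bar{\mathscr L}(\boldsymbol\theta),$$ where $\nabla\bar{\mathscr L}$ is the gradient with respect to $(\theta_1,\dots,\theta_q)$, written as a row vector.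
   Context: A prime denotes transpose. The polynomial $\boldsymbol\theta(L)$ is identified with its coefficient vector $(\theta_1,\dots,\theta_q)\in\mathbb R^q$; $\theta_0=1$. Root inversion map: near a $\boldsymbol\theta$ with pairwise distinct $\lambda_l$, the $\lambda_l$ are smooth functions of the coefficients (with a continuously chosen ordering). $IR_{i_1\cdots i_r}$ sends the coefficient vector of $\prod_{l}(1-\lambda_lL)$ to the coefficient vector of $\prod_{i\notin\{i_1,\dots,i_r\}}(1-\lambda_iL)\prod_{i\in\{i_1,\dots,i_r\}}(1-\lambda_i^{-1}L)$. Definition of $\bar{\mathscr L}$: $\Theta_T$ is the $T\times T$ lower triangular Toeplitz matrix with $(i,j)$ entry $\theta_{i-j}$ if $0\le i-j\le q$, else $0$. $\Theta_*$ is the $q\times q$ upper triangular matrix with $(i,j)$ entry $\theta_{q-(j-i)}$ if $j\ge i$, else $0$; $\Theta_{*;T-q}$ is the $T\times q$ matrix with $\Theta_*$ on top of a zero block. $\lambda=\Theta_T^{-1}\Theta_{*;T-q}$ (a matrix, distinct from the scalars $\lambda_l$), $K=I_T-\lambda(\lambda'\lambda+I_q)^{-1}\lambda'$. Data are row vectors $X_1,\dots,X_{T+p}\in\mathbb R^{1\times k}$; $L^i\mathbf X$ ($0\le i\le p$, $\mathbf X=L^0\mathbf X$) is the $T\times k$ matrix with rows $X_{p-i+1},\dots,X_{T+p-i}$; $\mathbf 1$ is the all-ones column of length $T$; $\mathbf X_\theta=\Theta_T^{-1}\mathbf X$; $\mathbf X_{\theta,\mathrm{lag}}=\Theta_T^{-1}(\mathbf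 1\;\;L\mathbf X\;\cdots\;L^p\mathbf X)$; $$\Omega_{opt}(\boldsymbol\theta)=\tfrac1T[\mathbf X_\theta'K\mathbf X_\theta-\mathbf X_\theta'K\mathbf X_{\theta,\mathrm{lag}}(\mathbf X_{\theta,\mathrm{lag}}'K\mathbf X_{\theta,\mathrm{lag}})^{-1}\mathbf X_{\theta,\mathrm{lag}}'K\mathbf X_\theta],$$ $$\bar{\mathscr L}(\boldsymbol\theta)=-\tfrac{Tk}2\log(2\pi)-\tfrac T2\log\det\Omega_{opt}(\boldsymbol\theta)-\tfrac k2\log\det(\lambda'\lambda+I_q)-\tfrac{Tk}2.$$ $\bar{\mathscr L}$ is defined when $\mathbf X_{\theta,\mathrm{lag}}'K\mathbf X_{\theta,\mathrm{lag}}$ is invertible and $\Omega_{opt}(\boldsymbol\theta)$ is positive definite. *)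

theory Defs
  imports
    "HOL-Analysis.Analysis"
    "HOL-Computational_Algebra.Polynomial"
    "Jordan_Normal_Form.Determinant"
    "Jordan_Normal_Form.Gauss_Jordan_Elimination"
begin

text \<open>
  The coefficient space is \<^typ>\<open>real ^ 'q\<close> with \<open>q = CARD('q)\<close>; the linear order on \<^typ>\<open>'q\<close>
  fixes which coordinate carries which coefficient. The matrices of the likelihood, whose sizes
  depend on numbers, have type \<open>real mat\<close>, with rows and columns indexed from 0.
  The infix \<open>$\<close> denotes only the component of a vector in \<^typ>\<open>real ^ 'q\<close>.
\<close>

no_notation Matrix.vec_index (infixl "$" 100)

definition ma_coeff :: "real ^ 'q::{finite, linorder} \<Rightarrow> nat \<Rightarrow> real" where
  "ma_coeff \<theta> n =
     (if n = 0 then 1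
      else if n \<le> CARD('q) then \<theta> $ (sorted_list_of_set (UNIV :: 'q set) ! (n - 1))
      else 0)"

definition ma_poly :: "real ^ 'q::{finite, linorder} \<Rightarrow> complex poly" where
  "ma_poly \<theta> = (\<Sum>n\<le>CARD('q). monom (complex_of_real (ma_coeff \<theta> n)) n)"

text \<open>
  \<open>is_root_inversion lam S \<theta> IR\<close>: on a neighbourhood of \<open>\<theta>\<close>, the map \<open>IR\<close> replaces \<open>\<lambda>\<^sub>l\<close> by its
  inverse for \<open>l \<in> S\<close>, where \<open>\<Lambda> l \<eta>\<close> is the continuous ordering of the \<open>\<lambda>\<^sub>l\<close> of \<open>\<eta>\<close> that starts
  from \<open>lam\<close> at \<open>\<theta>\<close>. For pairwise distinct \<open>lam l\<close> this determines the germ of \<open>IR\<close> at \<open>\<theta>\<close>;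
  the values of \<open>IR\<close> away from \<open>\<theta>\<close> are arbitrary.
\<close>

definition is_root_inversion ::
  "(nat \<Rightarrow> complex) \<Rightarrow> nat set \<Rightarrow> real ^ 'q::{finite, linorder} \<Rightarrow>
   (real ^ 'q::{finite, linorder} \<Rightarrow> real ^ 'q::{finite, linorder}) \<Rightarrow> bool" where
  "is_root_inversion lam S \<theta> IR \<longleftrightarrow>
     (\<exists>U \<Lambda>. open U \<and> \<theta> \<in> U \<and>
        (\<forall>l\<in>{1..CARD('q)}. continuous_on U (\<Lambda> l) \<and> \<Lambda> l \<theta> = lam l) \<and>
        (\<forall>\<eta>\<in>U.
           ma_poly \<eta> = (\<Prod>l\<in>{1..CARD('q)}. [:1, - \<Lambda> l \<eta>:]) \<and>
           ma_poly (IR \<eta>) =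
             (\<Prod>l\<in>{1..CARD('q)} - S. [:1, - \<Lambda> l \<eta>:]) *
             (\<Prod>l\<in>S. [:1, - inverse (\<Lambda> l \<eta>):])))"

definition complex_eigenvalue :: "real ^ 'n ^ 'n \<Rightarrow> complex \<Rightarrow> bool" where
  "complex_eigenvalue A \<mu> \<longleftrightarrow>
     (\<exists>v :: complex ^ 'n. v \<noteq> 0 \<and> (\<chi> i j. complex_of_real (A $ i $ j)) *v v = \<mu> *s v)"

text \<open>Meaningful only for invertible matrices, since \<open>mat_inverse\<close> returns \<open>None\<close> otherwise.\<close>

definition mat_inv :: "real mat \<Rightarrow> real mat" where
  "mat_inv A = the (mat_inverse A)"

definition pos_definite :: "real mat \<Rightarrow> bool" where
  "pos_definite A \<longleftrightarrow>
     square_mat A \<and> A\<^sup>T = A \<and>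
     (\<forall>v\<in>carrier_vec (dim_row A). v \<noteq> 0\<^sub>v (dim_row A) \<longrightarrow> scalar_prod v (A *\<^sub>v v) > 0)"

definition Theta_mat :: "nat \<Rightarrow> real ^ 'q::{finite, linorder} \<Rightarrow> real mat" where
  "Theta_mat T \<theta> = mat T T (\<lambda>(i, j). if j \<le> i then ma_coeff \<theta> (i - j) else 0)"

definition Theta_star :: "real ^ 'q::{finite, linorder} \<Rightarrow> real mat" where
  "Theta_star \<theta> =
     mat CARD('q) CARD('q) (\<lambda>(i, j). if i \<le> j then ma_coeff \<theta> (CARD('q) - (j - i)) else 0)"

definition lambda_mat :: "nat \<Rightarrow> real ^ 'q::{finite, linorder} \<Rightarrow> real mat" where
  "lambda_mat T \<theta> =
     mat_inv (Theta_mat T \<theta>) * (Theta_star \<theta> @\<^sub>r 0\<^sub>m (T - CARD('q)) CARD('q))"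

definition gram_lambda :: "nat \<Rightarrow> real ^ 'q::{finite, linorder} \<Rightarrow> real mat" where
  "gram_lambda T \<theta> = (lambda_mat T \<theta>)\<^sup>T * lambda_mat T \<theta> + 1\<^sub>m CARD('q)"

definition K_mat :: "nat \<Rightarrow> real ^ 'q::{finite, linorder} \<Rightarrow> real mat" where
  "K_mat T \<theta> =
     1\<^sub>m T - lambda_mat T \<theta> * mat_inv (gram_lambda T \<theta>) * (lambda_mat T \<theta>)\<^sup>T"

text \<open>
  Data: \<open>X t j\<close> is component \<open>j < k\<close> of the observation at time \<open>t \<in> {1..T + p}\<close>.
  \<open>lag_data X p T k i\<close> has the rows \<open>X (p - i + 1), \<dots>, X (T + p - i)\<close>, for \<open>i \<le> p\<close>.
  In \<open>regressors\<close>, column \<open>0\<close> is constant and lag \<open>i \<in> {1..p}\<close> occupies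
  columns \<open>1 + (i - 1) * k, \<dots>, i * k\<close>.
\<close>

definition lag_data :: "(nat \<Rightarrow> nat \<Rightarrow> real) \<Rightarrow> nat \<Rightarrow> nat \<Rightarrow> nat \<Rightarrow> nat \<Rightarrow> real mat" where
  "lag_data X p T k i = mat T k (\<lambda>(t, j). X (p - i + 1 + t) j)"

definition regressors :: "(nat \<Rightarrow> nat \<Rightarrow> real) \<Rightarrow> nat \<Rightarrow> nat \<Rightarrow> nat \<Rightarrow> real mat" where
  "regressors X p T k =
     mat T (1 + p * k) (\<lambda>(t, c).
       if c = 0 then 1 else lag_data X p T k ((c - 1) div k + 1) $$ (t, (c - 1) mod k))"

definition X_theta ::
  "(nat \<Rightarrow> nat \<Rightarrow> real) \<Rightarrow> nat \<Rightarrow> nat \<Rightarrow> nat \<Rightarrow> real ^ 'q::{finite, linorder} \<Rightarrow> real mat" where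
  "X_theta X p T k \<theta> = mat_inv (Theta_mat T \<theta>) * lag_data X p T k 0"

definition X_theta_lag ::
  "(nat \<Rightarrow> nat \<Rightarrow> real) \<Rightarrow> nat \<Rightarrow> nat \<Rightarrow> nat \<Rightarrow> real ^ 'q::{finite, linorder} \<Rightarrow> real mat" where
  "X_theta_lag X p T k \<theta> = mat_inv (Theta_mat T \<theta>) * regressors X p T k"

definition lag_gram ::
  "(nat \<Rightarrow> nat \<Rightarrow> real) \<Rightarrow> nat \<Rightarrow> nat \<Rightarrow> nat \<Rightarrow> real ^ 'q::{finite, linorder} \<Rightarrow> real mat" where
  "lag_gram X p T k \<theta> =
     (X_theta_lag X p T k \<theta>)\<^sup>T * K_mat T \<theta> * X_theta_lag X p T k \<theta>"

definition Omega_opt ::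
  "(nat \<Rightarrow> nat \<Rightarrow> real) \<Rightarrow> nat \<Rightarrow> nat \<Rightarrow> nat \<Rightarrow> real ^ 'q::{finite, linorder} \<Rightarrow> real mat" where
  "Omega_opt X p T k \<theta> =
     (let Y = X_theta X p T k \<theta>; Z = X_theta_lag X p T k \<theta>; K = K_mat T \<theta>
      in (1 / real T) \<cdot>\<^sub>m
         (Y\<^sup>T * K * Y - Y\<^sup>T * K * Z * mat_inv (lag_gram X p T k \<theta>) * Z\<^sup>T * K * Y))"

definition lik_defined ::
  "(nat \<Rightarrow> nat \<Rightarrow> real) \<Rightarrow> nat \<Rightarrow> nat \<Rightarrow> nat \<Rightarrow> real ^ 'q::{finite, linorder} \<Rightarrow> bool" where
  "lik_defined X p T k \<theta> \<longleftrightarrow>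
     invertible_mat (lag_gram X p T k \<theta>) \<and> pos_definite (Omega_opt X p T k \<theta>)"

definition Lbar ::
  "(nat \<Rightarrow> nat \<Rightarrow> real) \<Rightarrow> nat \<Rightarrow> nat \<Rightarrow> nat \<Rightarrow> real ^ 'q::{finite, linorder} \<Rightarrow> real" where
  "Lbar X p T k \<theta> =
     - (real T * real k / 2) * ln (2 * pi)
     - real T / 2 * ln (Determinant.det (Omega_opt X p T k \<theta>))
     - real k / 2 * ln (Determinant.det (gram_lambda T \<theta>))
     - real T * real k / 2"

end

theory Submission
  imports Defs "HOL-Computational_Algebra.Fundamental_Theorem_Algebra"
begin

text \<open>
  If \<open>IR\<close> fixes \<open>\<theta>\<close>, then inversion permutes the \<open>\<lambda>\<^sub>l\<close> with \<open>l \<in> S\<close>. As the \<open>\<lambda>\<^sub>l\<close> are distinct,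
  their continuous branches follow this permutation, so \<open>IR \<circ> IR\<close> is the identity near \<open>\<theta>\<close> and
  \<open>J[IR]\<^sup>2 = I\<close> by the chain rule.

  By the Woodbury identity, \<open>\<Theta>\<^sub>T\<^sup>-\<^sup>1' K \<Theta>\<^sub>T\<^sup>-\<^sup>1\<close> is the inverse of the Toeplitz matrix of the autocovariances
  \<open>\<gamma>(h) = \<Sum>\<^sub>n \<theta>\<^sub>n \<theta>\<^sub>n\<^sub>+\<^sub>h\<close>, whose determinant is \<open>det (\<lambda>'\<lambda> + I)\<close>. Since
  \<open>(1 - z/\<lambda>)(1 - 1/(\<lambda>z)) = \<lambda>\<^sup>-\<^sup>2 (1 - \<lambda>z)(1 - \<lambda>/z)\<close>, root inversion multiplies all \<open>\<gamma>(h)\<close> by a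
  constant \<open>c > 0\<close>. In the likelihood the powers of \<open>c\<close> from the two determinants cancel, so the
  likelihood is invariant under \<open>IR\<close> near \<open>\<theta>\<close>, and the chain rule gives the gradient identity.
\<close>

subsection \<open>Inverses and determinants of real matrices\<close>

lemma mat_inv_props:
  assumes A: "A \<in> carrier_mat n n" and d: "Determinant.det A \<noteq> 0"
  shows "mat_inv A \<in> carrier_mat n n" "A * mat_inv A = 1\<^sub>m n" "mat_inv A * A = 1\<^sub>m n"
proof -
  \<comment> \<open>The tag \<open>b\<close> of the matrix ring is arbitrary; fixing it makes both
    facts speak of the same set of units.\<close>
  have "mat_inverse A \<noteq> None"
    using mat_inverse(1)[OF A, where b = "()"] det_non_zero_imp_unit[OF A d, where b = "()"] by blast
  then obtain B where B: "mat_inverse A = Some B" by blast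
  have [simp]: "mat_inv A = B" by (simp add: mat_inv_def B)
  show "mat_inv A \<in> carrier_mat n n" "A * mat_inv A = 1\<^sub>m n" "mat_inv A * A = 1\<^sub>m n"
    using mat_inverse(2)[OF A B] by simp_all
qed

lemma det_nonzero_if_inverse:
  assumes "A \<in> carrier_mat n n" "B \<in> carrier_mat n n" "A * B = 1\<^sub>m n"
  shows "Determinant.det (A :: real mat) \<noteq> 0"
proof
  assume "Determinant.det A = 0"
  hence "Determinant.det (A * B) = 0" using Determinant.det_mult[OF assms(1,2)] by simp
  thus False by (simp add: assms(3))
qed

lemma mat_inv_unique:
  assumes A: "A \<in> carrier_mat n n" and B: "B \<in> carrier_mat n n" and AB: "A * B = 1\<^sub>m n"
  shows "mat_inv A = B"
proof -
  note P = mat_inv_props[OF A det_nonzero_if_inverse[OF A B AB]]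
  have "mat_inv A = mat_inv A * (A * B)" using P(1) AB by simp
  also have "\<dots> = (mat_inv A * A) * B" using assoc_mult_mat[OF P(1) A B] by simp
  also have "\<dots> = B" using P(3) B by simp
  finally show ?thesis .
qed

lemma det_nonzero_if_invertible:
  assumes A: "A \<in> carrier_mat n n" and inv: "invertible_mat (A :: real mat)"
  shows "Determinant.det A \<noteq> 0"
proof -
  from inv obtain B where B: "A * B = 1\<^sub>m (dim_row A)" "B * A = 1\<^sub>m (dim_row B)"
    unfolding invertible_mat_def inverts_mat_def by auto
  have "dim_col B = n" using arg_cong[OF B(1), of dim_col] A by simp
  moreover have "dim_row B = n" using arg_cong[OF B(2), of dim_col] A by simp
  ultimately have "B \<in> carrier_mat n n" by auto
  with A B show ?thesis by (intro det_nonzero_if_inverse[of A n B]) auto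
qed

lemma mat_inv_smult:
  assumes A: "A \<in> carrier_mat n n" and d: "Determinant.det A \<noteq> 0" and c: "c \<noteq> 0"
  shows "mat_inv (c \<cdot>\<^sub>m A) = inverse c \<cdot>\<^sub>m mat_inv A"
proof (rule mat_inv_unique)
  note P = mat_inv_props[OF A d]
  have "(c \<cdot>\<^sub>m A) * (inverse c \<cdot>\<^sub>m mat_inv A) = inverse c \<cdot>\<^sub>m (c \<cdot>\<^sub>m (A * mat_inv A))"
    using A P(1) by (simp add: mult_smult_assoc_mat[of _ n n _ n] mult_smult_distrib[of _ n n _ n])
  also have "\<dots> = 1\<^sub>m n" using c P by (auto intro!: eq_matI)
  finally show "(c \<cdot>\<^sub>m A) * (inverse c \<cdot>\<^sub>m mat_inv A) = 1\<^sub>m n" .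
qed (use mat_inv_props[OF A d] A in auto)

text \<open>Cramer's rule. It turns the entries of the inverse into quotients of polynomials in the
  entries of \<open>A\<close>, from which differentiability can be read off.\<close>

lemma mat_inv_eq_adj_mat:
  assumes A: "A \<in> carrier_mat n n" and d: "Determinant.det A \<noteq> 0"
  shows "mat_inv A = inverse (Determinant.det A) \<cdot>\<^sub>m adj_mat A"
proof (rule mat_inv_unique)
  note P = adj_mat[OF A]
  have "A * (inverse (Determinant.det A) \<cdot>\<^sub>m adj_mat A)
      = inverse (Determinant.det A) \<cdot>\<^sub>m (A * adj_mat A)"
    using A P by (simp add: mult_smult_distrib[of _ n n _ n])
  also have "\<dots> = 1\<^sub>m n" using d P by (auto intro!: eq_matI)
  finally show "A * (inverse (Determinant.det A) \<cdot>\<^sub>m adj_mat A) = 1\<^sub>m n" .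
qed (use adj_mat[OF A] A in auto)

text \<open>Sylvester's identity. Both products of the block matrices \<open>L\<close> and
  \<open>M\<close> are block upper triangular; their determinants agree and are the two
  sides.\<close>

lemma det_one_plus_mult_comm:
  fixes A B :: "real mat"
  assumes A: "A \<in> carrier_mat n m" and B: "B \<in> carrier_mat m n"
  shows "Determinant.det (1\<^sub>m n + A * B) = Determinant.det (1\<^sub>m m + B * A)"
proof -
  define M where "M = four_block_mat (1\<^sub>m n) (-A) B (1\<^sub>m m)"
  define L where "L = four_block_mat (1\<^sub>m n) (0\<^sub>m n m) (-B) (1\<^sub>m m)"
  have M: "M \<in> carrier_mat (n+m) (n+m)" and L: "L \<in> carrier_mat (n+m) (n+m)"
    using A B by (auto simp: M_def L_def)
  have "L * M = four_block_mat (1\<^sub>m n * 1\<^sub>m n + 0\<^sub>m n m * B) (1\<^sub>m n * (-A) + 0\<^sub>m n m * 1\<^sub>m m)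
      (-B * 1\<^sub>m n + 1\<^sub>m m * B) (-B * (-A) + 1\<^sub>m m * 1\<^sub>m m)"
    unfolding L_def M_def by (rule mult_four_block_mat) (use A B in auto)
  also have "\<dots> = four_block_mat (1\<^sub>m n) (-A) (0\<^sub>m m n) (1\<^sub>m m + B * A)"
    using A B by (intro cong_four_block_mat) (auto simp: comm_add_mat[of _ m m])
  finally have 1: "Determinant.det (L * M) = Determinant.det (1\<^sub>m m + B * A)"
    using A B by (simp add: det_four_block_mat_lower_left_zero[of _ n _ m])
  have "M * L = four_block_mat (1\<^sub>m n * 1\<^sub>m n + (-A) * (-B)) (1\<^sub>m n * 0\<^sub>m n m + (-A) * 1\<^sub>m m)
      (B * 1\<^sub>m n + 1\<^sub>m m * (-B)) (B * 0\<^sub>m n m + 1\<^sub>m m * 1\<^sub>m m)"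
    unfolding L_def M_def by (rule mult_four_block_mat) (use A B in auto)
  also have "\<dots> = four_block_mat (1\<^sub>m n + A * B) (-A) (0\<^sub>m m n) (1\<^sub>m m)"
    using A B by (intro cong_four_block_mat) auto
  finally have 2: "Determinant.det (M * L) = Determinant.det (1\<^sub>m n + A * B)"
    using A B by (simp add: det_four_block_mat_lower_left_zero[of _ n _ m])
  from 1 2 show ?thesis
    by (simp add: Determinant.det_mult[OF M L] Determinant.det_mult[OF L M] mult.commute)
qed

text \<open>Along the segment from the identity to \<open>A\<close> the quadratic form stays
  positive at nonzero vectors, so the determinant never vanishes there. It is 1 at the identity,
  hence positive at \<open>A\<close> by the intermediate value theorem.\<close>

lemma pos_definite_det_pos:
  assumes P: "pos_definite A"
  shows "Determinant.det A > 0"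
proof (rule ccontr)
  assume neg: "\<not> Determinant.det A > 0"
  define n where "n = dim_row A"
  have A: "A \<in> carrier_mat n n" using P by (auto simp: pos_definite_def n_def)
  define f where "f t = Determinant.det (t \<cdot>\<^sub>m A + (1 - t) \<cdot>\<^sub>m 1\<^sub>m n)" for t
  have C: "t \<cdot>\<^sub>m A + (1 - t) \<cdot>\<^sub>m 1\<^sub>m n \<in> carrier_mat n n" for t using A by auto
  have "continuous_on {0..1} (\<lambda>t. (t \<cdot>\<^sub>m A + (1 - t) \<cdot>\<^sub>m 1\<^sub>m n) $$ (i, j))" if "i < n" "j < n" for i j
    using A that by (auto intro!: continuous_intros)
  hence cont: "continuous_on {0..1} f"
    unfolding f_def det_def'[OF C]
    by (intro continuous_intros) (auto simp: permutes_in_image finite_permutations)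
  have "f 0 = Determinant.det (1\<^sub>m n :: real mat)"
    unfolding f_def using A by (intro arg_cong[of _ _ Determinant.det] eq_matI) auto
  hence f0: "f 0 = 1" by simp
  have "f 1 = Determinant.det A"
    unfolding f_def using A by (intro arg_cong[of _ _ Determinant.det] eq_matI) auto
  hence f1: "f 1 \<le> 0" using neg by simp
  obtain t where t: "0 \<le> t" "t \<le> 1" "f t = 0"
    using IVT2'[of f 1 0 0] f0 f1 cont by auto
  \<comment> \<open>Pairing a kernel vector with its own image writes 0 as a convex combination of
    two positive numbers.\<close>
  then obtain v where v: "v \<in> carrier_vec n" "v \<noteq> 0\<^sub>v n"
    "(t \<cdot>\<^sub>m A + (1 - t) \<cdot>\<^sub>m 1\<^sub>m n) *\<^sub>v v = 0\<^sub>v n"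
    unfolding f_def det_0_iff_vec_prod_zero[OF C] by blast
  have smv: "(c \<cdot>\<^sub>m B) *\<^sub>v v = c \<cdot>\<^sub>v (B *\<^sub>v v)" if "B \<in> carrier_mat n n" for B and c :: real
    using that v by (intro eq_vecI) (auto simp: scalar_prod_def sum_distrib_left mult.assoc)
  have "(t \<cdot>\<^sub>m A + (1 - t) \<cdot>\<^sub>m 1\<^sub>m n) *\<^sub>v v = t \<cdot>\<^sub>v (A *\<^sub>v v) + (1 - t) \<cdot>\<^sub>v v"
    using A v by (simp add: add_mult_distrib_mat_vec[of _ n n] smv)
  with v(3) have "t \<cdot>\<^sub>v (A *\<^sub>v v) + (1 - t) \<cdot>\<^sub>v v = 0\<^sub>v n" by simp
  hence "0 = scalar_prod v (t \<cdot>\<^sub>v (A *\<^sub>v v) + (1 - t) \<cdot>\<^sub>v v)"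
    using scalar_prod_right_zero[OF v(1)] by (simp only:)
  also have "\<dots> = t * scalar_prod v (A *\<^sub>v v) + (1 - t) * scalar_prod v v"
    using A v by (simp add: scalar_prod_add_distrib[of _ n])
  finally have z: "t * scalar_prod v (A *\<^sub>v v) + (1 - t) * scalar_prod v v = 0" by simp
  have p1: "scalar_prod v (A *\<^sub>v v) > 0" using P v n_def by (auto simp: pos_definite_def)
  have p2: "scalar_prod v v > 0"
    using v conjugate_square_greater_0_vec[of v n] by simp
  show False
  proof (cases "t = 0")
    case False
    hence "t * scalar_prod v (A *\<^sub>v v) > 0" using t p1 by simp
    moreover have "(1 - t) * scalar_prod v v \<ge> 0" using t p2 by simp
    ultimately show False using z by linarith
  qed (use z p2 in simp)
qed

lemma pos_definite_gram_plus_one: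
  assumes A: "A \<in> carrier_mat n m"
  shows "pos_definite (A\<^sup>T * A + 1\<^sub>m m)"
proof -
  have "0 < scalar_prod v ((A\<^sup>T * A + 1\<^sub>m m) *\<^sub>v v)" if v: "v \<in> carrier_vec m" "v \<noteq> 0\<^sub>v m" for v
  proof -
    have "(A\<^sup>T * A + 1\<^sub>m m) *\<^sub>v v = A\<^sup>T *\<^sub>v (A *\<^sub>v v) + v"
      using A v by (simp add: add_mult_distrib_mat_vec[of _ m m])
    hence "scalar_prod v ((A\<^sup>T * A + 1\<^sub>m m) *\<^sub>v v) = scalar_prod v (A\<^sup>T *\<^sub>v (A *\<^sub>v v)) + scalar_prod v v"
      using A v by (simp add: scalar_prod_add_distrib[of _ m])
    also have "scalar_prod v (A\<^sup>T *\<^sub>v (A *\<^sub>v v)) = scalar_prod (A *\<^sub>v v) (A *\<^sub>v v)"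
      using transpose_vec_mult_scalar[OF A v(1), of "A *\<^sub>v v"] A v
      by (simp add: comm_scalar_prod[of v m "A\<^sup>T *\<^sub>v (A *\<^sub>v v)"])
    finally have "scalar_prod v ((A\<^sup>T * A + 1\<^sub>m m) *\<^sub>v v)
      = scalar_prod (A *\<^sub>v v) (A *\<^sub>v v) + scalar_prod v v" .
    moreover have "scalar_prod v v > 0" using v conjugate_square_greater_0_vec[of v m] by simp
    moreover have "scalar_prod (A *\<^sub>v v) (A *\<^sub>v v) \<ge> 0"
      by (auto simp: scalar_prod_def intro!: sum_nonneg)
    ultimately show ?thesis by linarith
  qed
  moreover have "(A\<^sup>T * A + 1\<^sub>m m)\<^sup>T = A\<^sup>T * A + 1\<^sub>m m"
    using A by (simp add: transpose_add[of _ m m] transpose_mult[of _ m n _ m])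
  ultimately show ?thesis using A by (auto simp: pos_definite_def)
qed

subsection \<open>Differentiability of matrix-valued functions\<close>

text \<open>Entrywise, since matrices of variable size form no normed space. The size is required on
  a whole neighbourhood because entries outside the dimensions are unspecified.\<close>

definition mat_differentiable ::
  "('a::real_normed_vector \<Rightarrow> real mat) \<Rightarrow> nat \<Rightarrow> nat \<Rightarrow> 'a \<Rightarrow> bool" where
  "mat_differentiable F n m x \<longleftrightarrow>
     (\<forall>\<^sub>F y in nhds x. F y \<in> carrier_mat n m) \<and>
     (\<forall>i<n. \<forall>j<m. (\<lambda>y. F y $$ (i, j)) differentiable (at x))"

text \<open>Entry formulas for matrix operations hold only where the sizes are right, hence only
  near \<open>x\<close>; differentiability is transferred across such local equalities.\<close>

lemma differentiable_cong_nhds: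
  assumes "\<forall>\<^sub>F y in nhds x. f y = g y" "f differentiable (at x)"
  shows "g differentiable (at x)"
proof -
  obtain D where "(f has_derivative D) (at x)" using assms(2) by (auto simp: differentiable_def)
  moreover have "f x = g x" using assms(1) eventually_nhds_x_imp_x by fastforce
  moreover have "\<forall>\<^sub>F y in at x. f y = g y" using assms(1) eventually_nhds_conv_at by blast
  ultimately have "(g has_derivative D) (at x)" using has_derivative_transform_eventually by blast
  thus ?thesis by (auto simp: differentiable_def)
qed

lemma differentiable_prod:
  fixes f :: "'i \<Rightarrow> 'a::real_normed_vector \<Rightarrow> 'b::real_normed_field"
  assumes "\<And>i. i \<in> I \<Longrightarrow> f i differentiable (at x)"
  shows "(\<lambda>x. \<Prod>i\<in>I. f i x) differentiable (at x)"
  using assms by (induction I rule: infinite_finite_induct) auto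

lemma mat_differentiable_const: "A \<in> carrier_mat n m \<Longrightarrow> mat_differentiable (\<lambda>_. A) n m x"
  by (simp add: mat_differentiable_def)

lemma mat_differentiable_transpose:
  assumes "mat_differentiable F n m x"
  shows "mat_differentiable (\<lambda>y. (F y)\<^sup>T) m n x"
  unfolding mat_differentiable_def
proof (intro conjI allI impI)
  show "\<forall>\<^sub>F y in nhds x. (F y)\<^sup>T \<in> carrier_mat m n"
    using assms by (auto simp: mat_differentiable_def)
  fix i j assume ij: "i < m" "j < n"
  have "\<forall>\<^sub>F y in nhds x. F y $$ (j, i) = (F y)\<^sup>T $$ (i, j)"
    using assms unfolding mat_differentiable_def by (auto elim!: eventually_mono simp: ij)
  thus "(\<lambda>y. (F y)\<^sup>T $$ (i, j)) differentiable (at x)"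
    by (rule differentiable_cong_nhds) (use assms ij in \<open>auto simp: mat_differentiable_def\<close>)
qed

lemma mat_differentiable_smult:
  assumes c: "c differentiable (at x)" and "mat_differentiable F n m x"
  shows "mat_differentiable (\<lambda>y. c y \<cdot>\<^sub>m F y) n m x"
  unfolding mat_differentiable_def
proof (intro conjI allI impI)
  show "\<forall>\<^sub>F y in nhds x. c y \<cdot>\<^sub>m F y \<in> carrier_mat n m"
    using assms by (auto simp: mat_differentiable_def elim!: eventually_mono)
  fix i j assume ij: "i < n" "j < m"
  have "\<forall>\<^sub>F y in nhds x. c y * F y $$ (i, j) = (c y \<cdot>\<^sub>m F y) $$ (i, j)"
    using assms unfolding mat_differentiable_def by (auto elim!: eventually_mono simp: ij)
  thus "(\<lambda>y. (c y \<cdot>\<^sub>m F y) $$ (i, j)) differentiable (at x)"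
    by (rule differentiable_cong_nhds) (use assms ij in \<open>auto simp: mat_differentiable_def\<close>)
qed

lemma mat_differentiable_add:
  assumes "mat_differentiable F n m x" "mat_differentiable G n m x"
  shows "mat_differentiable (\<lambda>y. F y + G y) n m x"
  unfolding mat_differentiable_def
proof (intro conjI allI impI)
  have ev: "\<forall>\<^sub>F y in nhds x. F y \<in> carrier_mat n m \<and> G y \<in> carrier_mat n m"
    using assms by (auto simp: mat_differentiable_def eventually_conj_iff)
  show "\<forall>\<^sub>F y in nhds x. F y + G y \<in> carrier_mat n m"
    using ev by (auto elim!: eventually_mono)
  fix i j assume ij: "i < n" "j < m"
  have "\<forall>\<^sub>F y in nhds x. F y $$ (i, j) + G y $$ (i, j) = (F y + G y) $$ (i, j)"
    using ev by (auto elim!: eventually_mono simp: ij)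
  thus "(\<lambda>y. (F y + G y) $$ (i, j)) differentiable (at x)"
    by (rule differentiable_cong_nhds) (use assms ij in \<open>auto simp: mat_differentiable_def\<close>)
qed

lemma mat_differentiable_diff:
  assumes "mat_differentiable F n m x" "mat_differentiable G n m x"
  shows "mat_differentiable (\<lambda>y. F y - G y) n m x"
  unfolding mat_differentiable_def
proof (intro conjI allI impI)
  have ev: "\<forall>\<^sub>F y in nhds x. F y \<in> carrier_mat n m \<and> G y \<in> carrier_mat n m"
    using assms by (auto simp: mat_differentiable_def eventually_conj_iff)
  show "\<forall>\<^sub>F y in nhds x. F y - G y \<in> carrier_mat n m"
    using ev by (auto elim!: eventually_mono)
  fix i j assume ij: "i < n" "j < m"
  have "\<forall>\<^sub>F y in nhds x. F y $$ (i, j) - G y $$ (i, j) = (F y - G y) $$ (i, j)"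
    using ev by (auto elim!: eventually_mono simp: ij)
  thus "(\<lambda>y. (F y - G y) $$ (i, j)) differentiable (at x)"
    by (rule differentiable_cong_nhds) (use assms ij in \<open>auto simp: mat_differentiable_def\<close>)
qed

lemma mat_differentiable_mult:
  assumes "mat_differentiable F n m x" "mat_differentiable G m l x"
  shows "mat_differentiable (\<lambda>y. F y * G y) n l x"
  unfolding mat_differentiable_def
proof (intro conjI allI impI)
  have ev: "\<forall>\<^sub>F y in nhds x. F y \<in> carrier_mat n m \<and> G y \<in> carrier_mat m l"
    using assms by (auto simp: mat_differentiable_def eventually_conj_iff)
  show "\<forall>\<^sub>F y in nhds x. F y * G y \<in> carrier_mat n l"
    using ev by (auto elim!: eventually_mono)
  fix i j assume ij: "i < n" "j < l"
  have "\<forall>\<^sub>F y in nhds x. (\<Sum>k\<in>{0..<m}. F y $$ (i, k) * G y $$ (k, j)) = (F y * G y) $$ (i, j)"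
    using ev by (rule eventually_mono) (auto simp: ij scalar_prod_def intro!: sum.cong)
  thus "(\<lambda>y. (F y * G y) $$ (i, j)) differentiable (at x)"
    by (rule differentiable_cong_nhds) (use assms ij in \<open>auto simp: mat_differentiable_def\<close>)
qed

lemma mat_differentiable_det:
  assumes "mat_differentiable F n n x"
  shows "(\<lambda>y. Determinant.det (F y)) differentiable (at x)"
proof -
  have "\<forall>\<^sub>F y in nhds x. (\<Sum>p | p permutes {0..<n}. of_int (sign p) * (\<Prod>i = 0..<n. F y $$ (i, p i)))
      = Determinant.det (F y)"
    using assms unfolding mat_differentiable_def
    by (auto elim!: eventually_mono simp: det_def')
  thus ?thesis
    by (rule differentiable_cong_nhds)
      (use assms in \<open>auto simp: mat_differentiable_def finite_permutations permutes_in_image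
        intro!: differentiable_prod differentiable_sum\<close>)
qed

text \<open>The determinant is continuous, so it stays nonzero near \<open>x\<close> and the
  adjugate formula holds on a neighbourhood: each entry is a signed minor divided by the
  determinant.\<close>

lemma mat_differentiable_mat_inv:
  assumes F: "mat_differentiable F n n x" and d: "Determinant.det (F x) \<noteq> 0"
  shows "mat_differentiable (\<lambda>y. mat_inv (F y)) n n x"
proof -
  have Fev: "\<forall>\<^sub>F y in nhds x. F y \<in> carrier_mat n n" using F by (simp add: mat_differentiable_def)
  have "isCont (\<lambda>y. Determinant.det (F y)) x"
    by (rule differentiable_imp_continuous_within[OF mat_differentiable_det[OF F]])
  hence "\<forall>\<^sub>F y in nhds x. Determinant.det (F y) \<noteq> 0"
    using d by (auto simp: continuous_at eventually_nhds_conv_at intro: tendsto_imp_eventually_ne)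
  with Fev have ev: "\<forall>\<^sub>F y in nhds x. F y \<in> carrier_mat n n \<and> Determinant.det (F y) \<noteq> 0"
    by (simp add: eventually_conj_iff)
  have minor: "mat_differentiable (\<lambda>y. mat_delete (F y) j i) (n - 1) (n - 1) x"
    if "i < n" "j < n" for i j
    unfolding mat_differentiable_def
  proof (intro conjI allI impI)
    show "\<forall>\<^sub>F y in nhds x. mat_delete (F y) j i \<in> carrier_mat (n - 1) (n - 1)"
      using Fev by (auto elim!: eventually_mono intro: mat_delete_carrier)
    fix k l assume kl: "k < n - 1" "l < n - 1"
    \<comment> \<open>Deleting row \<open>j\<close> and column \<open>i\<close> shifts the later
      indices by one.\<close>
    have "\<forall>\<^sub>F y in nhds x. F y $$ (if k < j then k else Suc k, if l < i then l else Suc l)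
        = mat_delete (F y) j i $$ (k, l)"
      using Fev by (rule eventually_mono) (use kl in \<open>auto simp: mat_delete_def\<close>)
    thus "(\<lambda>y. mat_delete (F y) j i $$ (k, l)) differentiable (at x)"
      by (rule differentiable_cong_nhds) (use F kl in \<open>auto simp: mat_differentiable_def\<close>)
  qed
  show ?thesis
    unfolding mat_differentiable_def
  proof (intro conjI allI impI)
    show "\<forall>\<^sub>F y in nhds x. mat_inv (F y) \<in> carrier_mat n n"
      using ev by (rule eventually_mono) (auto intro: mat_inv_props)
    fix i j assume ij: "i < n" "j < n"
    have "\<forall>\<^sub>F y in nhds x.
        inverse (Determinant.det (F y)) * ((-1) ^ (j + i) * Determinant.det (mat_delete (F y) j i))
        = mat_inv (F y) $$ (i, j)"
      using ev
    proof (rule eventually_mono)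
      fix y assume y: "F y \<in> carrier_mat n n \<and> Determinant.det (F y) \<noteq> 0"
      hence "adj_mat (F y) $$ (i, j) = cofactor (F y) j i" "adj_mat (F y) \<in> carrier_mat n n"
        using ij adj_mat(1)[of "F y" n] by (auto simp: adj_mat_def)
      thus "inverse (Determinant.det (F y)) * ((-1) ^ (j + i) * Determinant.det (mat_delete (F y) j i))
        = mat_inv (F y) $$ (i, j)"
        using y ij by (simp add: mat_inv_eq_adj_mat[of _ n] cofactor_def)
    qed
    thus "(\<lambda>y. mat_inv (F y) $$ (i, j)) differentiable (at x)"
      by (rule differentiable_cong_nhds)
        (use minor[OF ij] mat_differentiable_det F d in \<open>auto intro!: derivative_intros\<close>)
  qed
qed

subsection \<open>The likelihood as a function of the autocovariances\<close>

text \<open>Side conditions on dimensions instead of carriers let the simplifier reassociate long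
  products without being told the sizes.\<close>

lemma mult_mat_assoc_dim:
  "dim_col A = dim_row B \<Longrightarrow> dim_col B = dim_row C \<Longrightarrow> A * B * C = A * (B * (C :: 'a::semiring_0 mat))"
  by (rule assoc_mult_mat[of A "dim_row A" "dim_col A" B "dim_col B" C "dim_col C"]) auto

lemma transpose_mult_dim:
  "dim_col A = dim_row B \<Longrightarrow> (A * B)\<^sup>T = B\<^sup>T * (A :: 'a::comm_semiring_0 mat)\<^sup>T"
  by (rule transpose_mult[of A "dim_row A" "dim_col A" B "dim_col B"]) auto

section \<open>Autocovariances of the moving average\<close>

lemma ma_coeff_eq_0: "n > CARD('q) \<Longrightarrow> ma_coeff (\<theta> :: real^'q::{finite,linorder}) n = 0"
  by (simp add: ma_coeff_def)

lemma ma_coeff_0 [simp]: "ma_coeff \<theta> 0 = 1"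
  by (simp add: ma_coeff_def)

text \<open>Autocovariance at lag \<open>h\<close> for uncorrelated innovations of variance one;
  summands with \<open>n + h > CARD('q)\<close> vanish.\<close>

definition acov :: "real ^ 'q::{finite, linorder} \<Rightarrow> nat \<Rightarrow> real" where
  "acov \<theta> h = (\<Sum>n\<le>CARD('q). ma_coeff \<theta> n * ma_coeff \<theta> (n + h))"

text \<open>The covariance matrix of \<open>T\<close> consecutive values. The case distinction
  stands for the absolute difference, as subtraction of naturals truncates.\<close>

definition acov_mat :: "nat \<Rightarrow> real ^ 'q::{finite, linorder} \<Rightarrow> real mat" where
  "acov_mat T \<theta> = mat T T (\<lambda>(i, j). acov \<theta> (if i \<le> j then j - i else i - j))"

abbreviation Theta_star_ext :: "nat \<Rightarrow> real ^ 'q::{finite, linorder} \<Rightarrow> real mat" where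
  "Theta_star_ext T \<theta> \<equiv> Theta_star \<theta> @\<^sub>r 0\<^sub>m (T - CARD('q)) CARD('q)"

lemma Theta_star_ext_carrier:
  assumes "T \<ge> CARD('q)"
  shows "Theta_star_ext T (\<theta> :: real^'q::{finite,linorder}) \<in> carrier_mat T CARD('q)"
  using carrier_append_rows[of "Theta_star \<theta>" "CARD('q)" "CARD('q)" "0\<^sub>m (T - CARD('q)) CARD('q)" "T - CARD('q)"] assms
  by (simp add: Theta_star_def)

text \<open>One formula serves both blocks: in the zero block \<open>i \<ge> CARD('q) > m\<close>,
  so the condition \<open>i \<le> m\<close> fails.\<close>

lemma Theta_star_ext_index:
  assumes "T \<ge> CARD('q)" "i < T" "m < CARD('q)"
  shows "Theta_star_ext T (\<theta> :: real^'q::{finite,linorder}) $$ (i, m)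
    = (if i \<le> m then ma_coeff \<theta> (CARD('q) + i - m) else 0)"
  using assms by (auto simp: append_rows_def Theta_star_def)

text \<open>In both Gram sums below, the index \<open>s\<close> is the lag of the first factor: \<open>Theta_mat\<close>
  contributes \<open>s \<le> i\<close>, and \<open>Theta_star\<close> the remaining \<open>i < s \<le> q\<close>.\<close>

lemma Theta_gram_sum:
  fixes \<theta> :: "real^'q::{finite,linorder}"
  assumes T: "T \<ge> CARD('q)" and ij: "i \<le> j" "j < T"
  shows "(\<Sum>m<T. Theta_mat T \<theta> $$ (i, m) * Theta_mat T \<theta> $$ (j, m))
    + (\<Sum>m<CARD('q). Theta_star_ext T \<theta> $$ (i, m) * Theta_star_ext T \<theta> $$ (j, m))
    = acov \<theta> (j - i)"
proof -
  let ?q = "CARD('q)"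
  define h where "h = j - i"
  define g where "g s = ma_coeff \<theta> s * ma_coeff \<theta> (s + h)" for s
  have "(\<Sum>m<T. Theta_mat T \<theta> $$ (i, m) * Theta_mat T \<theta> $$ (j, m))
     = (\<Sum>m\<le>i. ma_coeff \<theta> (i - m) * ma_coeff \<theta> (j - m))"
    using ij by (intro sum.mono_neutral_cong_right) (auto simp: Theta_mat_def)
  also have "\<dots> = sum g {..i}"
    using ij by (intro sum.reindex_bij_witness[of _ "\<lambda>s. i - s" "\<lambda>m. i - m"])
      (auto simp: g_def h_def)
  finally have 1: "(\<Sum>m<T. Theta_mat T \<theta> $$ (i, m) * Theta_mat T \<theta> $$ (j, m)) = sum g {..i}" .
  have "(\<Sum>m<?q. Theta_star_ext T \<theta> $$ (i, m) * Theta_star_ext T \<theta> $$ (j, m))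
     = (\<Sum>m\<in>{j..<?q}. ma_coeff \<theta> (?q + i - m) * ma_coeff \<theta> (?q + j - m))"
    using T ij by (intro sum.mono_neutral_cong_right) (auto simp: Theta_star_ext_index)
  also have "\<dots> = sum g {s. i < s \<and> s + h \<le> ?q}"
    using ij by (intro sum.reindex_bij_witness[of _ "\<lambda>s. ?q + i - s" "\<lambda>m. ?q + i - m"])
      (auto simp: g_def h_def)
  \<comment> \<open>The added indices have \<open>s + h > ?q\<close>, where \<open>g\<close>
    vanishes. The new range adjoins \<open>{..i}\<close> whether or not \<open>i\<close> exceeds
    \<open>?q\<close>.\<close>
  also have "\<dots> = sum g {i<..i + ?q}"
    by (intro sum.mono_neutral_left) (auto simp: g_def ma_coeff_def split: if_splits)
  finally have 2: "(\<Sum>m<?q. Theta_star_ext T \<theta> $$ (i, m) * Theta_star_ext T \<theta> $$ (j, m))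
     = sum g {i<..i + ?q}" .
  have "sum g {..i} + sum g {i<..i + ?q} = sum g ({..i} \<union> {i<..i + ?q})"
    by (rule sum.union_disjoint[symmetric]) auto
  also have "{..i} \<union> {i<..i + ?q} = {..i + ?q}" by auto
  also have "sum g {..i + ?q} = sum g {..?q}"
    by (intro sum.mono_neutral_right) (auto simp: g_def ma_coeff_eq_0)
  finally show ?thesis by (simp add: 1 2 acov_def g_def h_def)
qed

text \<open>The \<open>T\<close> values are \<open>Theta_mat\<close> applied to the innovations of
  the sample plus \<open>Theta_star_ext\<close> applied to the presample innovations. As all of
  these are uncorrelated, the covariance is the sum of the two Gram matrices.\<close>

lemma acov_mat_eq:
  fixes \<theta> :: "real^'q::{finite,linorder}"
  assumes T: "T \<ge> CARD('q)"
  shows "acov_mat T \<theta> = Theta_mat T \<theta> * (Theta_mat T \<theta>)\<^sup>T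
    + Theta_star_ext T \<theta> * (Theta_star_ext T \<theta>)\<^sup>T" (is "_ = ?R")
proof (rule eq_matI)
  have [simp]: "dim_row (Theta_star_ext T \<theta>) = T" "dim_col (Theta_star_ext T \<theta>) = CARD('q)"
    "dim_row (Theta_mat T \<theta>) = T" "dim_col (Theta_mat T \<theta>) = T"
    using Theta_star_ext_carrier[OF T, of \<theta>] by (auto simp: Theta_mat_def)
  show "dim_row (acov_mat T \<theta>) = dim_row ?R" "dim_col (acov_mat T \<theta>) = dim_col ?R"
    by (simp_all add: acov_mat_def)
  fix i j assume "i < dim_row ?R" "j < dim_col ?R"
  hence ij: "i < T" "j < T" by simp_all
  have R: "?R $$ (i, j) = (\<Sum>m<T. Theta_mat T \<theta> $$ (i, m) * Theta_mat T \<theta> $$ (j, m))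
    + (\<Sum>m<CARD('q). Theta_star_ext T \<theta> $$ (i, m) * Theta_star_ext T \<theta> $$ (j, m))"
    using ij by (simp add: scalar_prod_def atLeast0LessThan)
  show "acov_mat T \<theta> $$ (i, j) = ?R $$ (i, j)"
  proof (cases "i \<le> j")
    case True
    thus ?thesis unfolding R using Theta_gram_sum[OF T, of i j \<theta>] ij by (simp add: acov_mat_def)
  next
    case False
    thus ?thesis unfolding R using Theta_gram_sum[OF T, of j i \<theta>] ij
      by (simp add: acov_mat_def mult.commute)
  qed
qed

lemma ma_coeff_differentiable:
  "(\<lambda>\<eta> :: real^'q::{finite,linorder}. ma_coeff \<eta> n) differentiable (at x)"
proof -
  have "(\<lambda>\<eta> :: real^'q::{finite,linorder}. \<eta> $ i) differentiable (at x)" for i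
    by (rule bounded_linear_imp_differentiable) (rule bounded_linear_vec_nth)
  thus ?thesis unfolding ma_coeff_def by (cases "n = 0"; cases "n \<le> CARD('q)") simp_all
qed

text \<open>Factoring out \<Theta> gives \<open>\<Sigma> = \<Theta> * W * \<Theta>\<^sup>T\<close>
  with \<open>W = 1\<^sub>m n + \<Lambda> * \<Lambda>\<^sup>T\<close>, and \<open>K\<close> is the
  inverse of \<open>W\<close>. The determinant of \<open>W\<close> reduces to that of the smaller
  \<open>M\<close> by Sylvester's identity. The definitions mirror those of the likelihood, so that
  an instance can be folded back.\<close>

lemma woodbury:
  fixes A B \<Theta> :: "real mat"
  assumes \<Theta>: "\<Theta> \<in> carrier_mat n n" and d: "Determinant.det \<Theta> \<noteq> 0" and B: "B \<in> carrier_mat n m"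
  defines "A \<equiv> mat_inv \<Theta>"
  defines "\<Lambda> \<equiv> A * B"
  defines "M \<equiv> \<Lambda>\<^sup>T * \<Lambda> + 1\<^sub>m m"
  defines "K \<equiv> 1\<^sub>m n - \<Lambda> * mat_inv M * \<Lambda>\<^sup>T"
  defines "\<Sigma> \<equiv> \<Theta> * \<Theta>\<^sup>T + B * B\<^sup>T"
  shows "mat_inv \<Sigma> = A\<^sup>T * K * A" "Determinant.det \<Sigma> = (Determinant.det \<Theta>)\<^sup>2 * Determinant.det M"
    "Determinant.det M > 0"
proof -
  note A = mat_inv_props[OF \<Theta> d, folded A_def]
  have \<Lambda>: "\<Lambda> \<in> carrier_mat n m" using A B by (simp add: \<Lambda>_def)
  show Mpos: "Determinant.det M > 0"
    unfolding M_def by (rule pos_definite_det_pos[OF pos_definite_gram_plus_one[OF \<Lambda>]])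
  have M: "M \<in> carrier_mat m m" using \<Lambda> by (simp add: M_def)
  have N: "mat_inv M \<in> carrier_mat m m" "mat_inv M * M = 1\<^sub>m m"
    using mat_inv_props[OF M] Mpos by auto
  note dims [simp] = carrier_matD[OF \<Theta>] carrier_matD[OF A(1)] carrier_matD[OF B]
    carrier_matD[OF \<Lambda>] carrier_matD[OF M] carrier_matD[OF N(1)]
  define W where "W = 1\<^sub>m n + \<Lambda> * \<Lambda>\<^sup>T"
  have W: "W \<in> carrier_mat n n" and K: "K \<in> carrier_mat n n" by (rule carrier_matI; simp add: W_def K_def)+
  note dims' [simp] = carrier_matD[OF W] carrier_matD[OF K]
  \<comment> \<open>The push-through identity: \<Lambda> transposed exchanges \<open>W\<close> for
    \<open>M\<close>, so that \<open>mat_inv M\<close> cancels in \<open>K * W\<close>.\<close>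
  have "\<Lambda>\<^sup>T * W = \<Lambda>\<^sup>T * 1\<^sub>m n + \<Lambda>\<^sup>T * (\<Lambda> * \<Lambda>\<^sup>T)"
    unfolding W_def by (rule mult_add_distrib_mat) (rule carrier_matI; simp)+
  also have "\<dots> = 1\<^sub>m m * \<Lambda>\<^sup>T + (\<Lambda>\<^sup>T * \<Lambda>) * \<Lambda>\<^sup>T"
    using \<Lambda> by (simp add: mult_mat_assoc_dim)
  also have "\<dots> = (\<Lambda>\<^sup>T * \<Lambda>) * \<Lambda>\<^sup>T + 1\<^sub>m m * \<Lambda>\<^sup>T"
    by (rule comm_add_mat[of _ m n]) (rule carrier_matI; simp)+
  also have "\<dots> = M * \<Lambda>\<^sup>T"
    unfolding M_def by (rule add_mult_distrib_mat[symmetric]) (rule carrier_matI; simp)+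
  finally have LW: "\<Lambda>\<^sup>T * W = M * \<Lambda>\<^sup>T" .
  have "K * W = 1\<^sub>m n * W - \<Lambda> * mat_inv M * \<Lambda>\<^sup>T * W"
    unfolding K_def by (rule minus_mult_distrib_mat) (rule carrier_matI; simp)+
  also have "\<dots> = W - \<Lambda> * (mat_inv M * (\<Lambda>\<^sup>T * W))"
    using W by (simp add: mult_mat_assoc_dim)
  also have "mat_inv M * (\<Lambda>\<^sup>T * W) = (mat_inv M * M) * \<Lambda>\<^sup>T"
    unfolding LW by (simp add: mult_mat_assoc_dim)
  also have "\<Lambda> * \<dots> = \<Lambda> * \<Lambda>\<^sup>T" using \<Lambda> by (simp add: N(2))
  also have "W - \<dots> = 1\<^sub>m n" unfolding W_def using \<Lambda> by (auto intro!: eq_matI)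
  finally have KW: "K * W = 1\<^sub>m n" .
  have TL: "\<Theta> * \<Lambda> = B"
    unfolding \<Lambda>_def using A(2) B assoc_mult_mat[OF \<Theta> A(1) B] by simp
  have "\<Theta> * W = \<Theta> * 1\<^sub>m n + \<Theta> * (\<Lambda> * \<Lambda>\<^sup>T)"
    unfolding W_def by (rule mult_add_distrib_mat) (rule carrier_matI; simp)+
  also have "\<dots> = \<Theta> + B * \<Lambda>\<^sup>T"
    using \<Theta> \<Lambda> assoc_mult_mat[OF \<Theta> \<Lambda>, of "\<Lambda>\<^sup>T" n] by (simp add: TL)
  finally have "\<Theta> * W * \<Theta>\<^sup>T = \<Theta> * \<Theta>\<^sup>T + B * \<Lambda>\<^sup>T * \<Theta>\<^sup>T"
    using add_mult_distrib_mat[of \<Theta> n n "B * \<Lambda>\<^sup>T" "\<Theta>\<^sup>T" n] \<Theta> \<Lambda> B by simp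
  also have "B * \<Lambda>\<^sup>T * \<Theta>\<^sup>T = B * (\<Theta> * \<Lambda>)\<^sup>T"
    by (simp add: mult_mat_assoc_dim transpose_mult_dim)
  finally have \<Sigma>W: "\<Sigma> = \<Theta> * W * \<Theta>\<^sup>T" by (simp add: TL \<Sigma>_def)
  have \<Sigma>: "\<Sigma> \<in> carrier_mat n n" unfolding \<Sigma>W by (rule carrier_matI; simp)
  have AT: "A\<^sup>T * \<Theta>\<^sup>T = 1\<^sub>m n"
    using arg_cong[OF A(2), of transpose_mat] by (simp add: transpose_mult_dim)
  \<comment> \<open>The inner factors cancel from the middle outwards; for square matrices a
    one-sided inverse is two-sided.\<close>
  have "(A\<^sup>T * K * A) * \<Sigma> = A\<^sup>T * (K * ((A * \<Theta>) * (W * \<Theta>\<^sup>T)))"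
    unfolding \<Sigma>W by (simp add: mult_mat_assoc_dim)
  also have "(A * \<Theta>) * (W * \<Theta>\<^sup>T) = W * \<Theta>\<^sup>T" using W \<Theta> by (simp add: A(3))
  also have "A\<^sup>T * (K * (W * \<Theta>\<^sup>T)) = A\<^sup>T * ((K * W) * \<Theta>\<^sup>T)" by (simp add: mult_mat_assoc_dim)
  also have "\<dots> = 1\<^sub>m n" using \<Theta> by (simp add: KW AT)
  finally have "(A\<^sup>T * K * A) * \<Sigma> = 1\<^sub>m n" .
  moreover have P: "A\<^sup>T * K * A \<in> carrier_mat n n" by (rule carrier_matI; simp)
  ultimately have "\<Sigma> * (A\<^sup>T * K * A) = 1\<^sub>m n" using mat_mult_left_right_inverse[OF P \<Sigma>] by simp
  thus "mat_inv \<Sigma> = A\<^sup>T * K * A" by (rule mat_inv_unique[OF \<Sigma> P])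
  have "Determinant.det W = Determinant.det (1\<^sub>m m + \<Lambda>\<^sup>T * \<Lambda>)"
    unfolding W_def by (rule det_one_plus_mult_comm) (rule carrier_matI; simp)+
  also have "1\<^sub>m m + \<Lambda>\<^sup>T * \<Lambda> = M" unfolding M_def using \<Lambda> by (simp add: comm_add_mat[of _ m m])
  finally show "Determinant.det \<Sigma> = (Determinant.det \<Theta>)\<^sup>2 * Determinant.det M"
    unfolding \<Sigma>W using \<Theta> W
    by (simp add: Determinant.det_mult[of _ n] Determinant.det_transpose[OF \<Theta>] power2_eq_square)
qed

text \<open>The matrix is unit lower triangular. Hence it is invertible at every coefficient vector,
  and its determinant disappears from the Woodbury formula.\<close>

lemma det_Theta_mat: "Determinant.det (Theta_mat T \<theta>) = 1"
proof -
  have "Determinant.det (Theta_mat T \<theta>) = prod_list (diag_mat (Theta_mat T \<theta>))"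
    by (rule det_lower_triangular[of T]) (auto simp: Theta_mat_def)
  also have "diag_mat (Theta_mat T \<theta>) = map (\<lambda>_. 1) [0..<T]"
    by (auto simp: diag_mat_def Theta_mat_def)
  finally show ?thesis by (simp add: prod_list_replicate map_replicate_const)
qed

lemma Theta_mat_carrier: "Theta_mat T \<theta> \<in> carrier_mat T T"
  by (simp add: Theta_mat_def)

lemma mat_inv_Theta_mat_carrier: "mat_inv (Theta_mat T \<theta>) \<in> carrier_mat T T"
  by (rule mat_inv_props[OF Theta_mat_carrier]) (simp add: det_Theta_mat)

text \<open>Both ingredients of the likelihood, the weight matrix between the data and the
  determinant term, are thereby functions of the autocovariances alone.\<close>

lemma acov_mat_woodbury:
  fixes \<theta> :: "real^'q::{finite,linorder}"
  assumes T: "T \<ge> CARD('q)"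
  shows "mat_inv (acov_mat T \<theta>) = (mat_inv (Theta_mat T \<theta>))\<^sup>T * K_mat T \<theta> * mat_inv (Theta_mat T \<theta>)"
    and "Determinant.det (acov_mat T \<theta>) = Determinant.det (gram_lambda T \<theta>)"
    and "Determinant.det (gram_lambda T \<theta>) > 0"
proof -
  have d: "Determinant.det (Theta_mat T \<theta>) \<noteq> 0" by (simp add: det_Theta_mat)
  note W = woodbury[OF Theta_mat_carrier[of T \<theta>] d Theta_star_ext_carrier[OF T, of \<theta>],
      folded acov_mat_eq[OF T], folded lambda_mat_def, folded gram_lambda_def, folded K_mat_def]
  show "mat_inv (acov_mat T \<theta>) = (mat_inv (Theta_mat T \<theta>))\<^sup>T * K_mat T \<theta> * mat_inv (Theta_mat T \<theta>)"
    by (rule W(1))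
  show "Determinant.det (acov_mat T \<theta>) = Determinant.det (gram_lambda T \<theta>)"
    by (simp only: W(2) det_Theta_mat) simp
  show "Determinant.det (gram_lambda T \<theta>) > 0" by (rule W(3))
qed

lemma lambda_mat_carrier:
  assumes "T \<ge> CARD('q)"
  shows "lambda_mat T (\<theta> :: real^'q::{finite,linorder}) \<in> carrier_mat T CARD('q)"
  unfolding lambda_mat_def
  by (rule mult_carrier_mat[OF mat_inv_Theta_mat_carrier Theta_star_ext_carrier[OF assms]])

lemma K_mat_carrier:
  assumes "T \<ge> CARD('q)"
  shows "K_mat T (\<theta> :: real^'q::{finite,linorder}) \<in> carrier_mat T T"
  using carrier_matD[OF lambda_mat_carrier[OF assms, of \<theta>]]
  by (intro carrier_matI) (simp_all add: K_mat_def)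

section \<open>The likelihood in terms of the autocovariances\<close>

lemma lag_data_carrier: "lag_data X p T k i \<in> carrier_mat T k"
  by (simp add: lag_data_def)

lemma regressors_carrier: "regressors X p T k \<in> carrier_mat T (1 + p * k)"
  by (simp add: regressors_def)

lemma acov_mat_carrier: "acov_mat T \<theta> \<in> carrier_mat T T"
  by (simp add: acov_mat_def)

lemma lag_gram_acov:
  fixes \<theta> :: "real^'q::{finite,linorder}"
  assumes T: "T \<ge> CARD('q)"
  shows "lag_gram X p T k \<theta>
    = (regressors X p T k)\<^sup>T * (mat_inv (acov_mat T \<theta>) * regressors X p T k)"
  unfolding lag_gram_def X_theta_lag_def acov_mat_woodbury(1)[OF T]
  using carrier_matD[OF mat_inv_Theta_mat_carrier[of T \<theta>]] carrier_matD[OF K_mat_carrier[OF T, of \<theta>]]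
    carrier_matD[OF regressors_carrier[of X p T k]]
  by (simp add: mult_mat_assoc_dim transpose_mult_dim)

lemma lag_gram_carrier:
  fixes \<theta> :: "real^'q::{finite,linorder}"
  shows "lag_gram X p T k \<theta> \<in> carrier_mat (1 + p * k) (1 + p * k)"
  by (rule carrier_matI)
    (simp_all add: lag_gram_def X_theta_lag_def carrier_matD[OF regressors_carrier[of X p T k]])

text \<open>Invertibility of the lag Gram matrix fixes the dimensions of its \<open>mat_inv\<close>,
  on which the reassociation of the products relies.\<close>

lemma Omega_opt_acov:
  fixes \<theta> :: "real^'q::{finite,linorder}"
  assumes T: "T \<ge> CARD('q)" and d: "Determinant.det (lag_gram X p T k \<theta>) \<noteq> 0"
  defines "Y \<equiv> lag_data X p T k 0" and "Z \<equiv> regressors X p T k" and "P \<equiv> mat_inv (acov_mat T \<theta>)"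
  shows "Omega_opt X p T k \<theta> = (1 / real T) \<cdot>\<^sub>m
    (Y\<^sup>T * (P * Y) - Y\<^sup>T * (P * (Z * (mat_inv (Z\<^sup>T * (P * Z)) * (Z\<^sup>T * (P * Y))))))"
  unfolding Omega_opt_def Let_def lag_gram_acov[OF T] X_theta_def X_theta_lag_def
    acov_mat_woodbury(1)[OF T] P_def Y_def Z_def
  using carrier_matD[OF mat_inv_Theta_mat_carrier[of T \<theta>]] carrier_matD[OF K_mat_carrier[OF T, of \<theta>]]
    carrier_matD[OF regressors_carrier[of X p T k]] carrier_matD[OF lag_data_carrier[of X p T k 0]]
    carrier_matD[OF mat_inv_props(1)[OF lag_gram_carrier d,
      unfolded lag_gram_acov[OF T] acov_mat_woodbury(1)[OF T]]]
  by (simp add: mult_mat_assoc_dim transpose_mult_dim)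

text \<open>The inverse covariance matrix scales by \<open>inverse c\<close>, and so does
  \<open>Omega_opt\<close>. Its determinant, of size \<open>k\<close>, scales by
  \<open>inverse c ^ k\<close>, that of \<open>gram_lambda\<close> by \<open>c ^ T\<close>; the
  weights \<open>T / 2\<close> and \<open>k / 2\<close> make the logarithms of \<open>c\<close>
  cancel.\<close>

lemma Lbar_scale:
  fixes \<theta> \<eta> :: "real^'q::{finite,linorder}"
  assumes T: "T \<ge> CARD('q)" and d: "Determinant.det (lag_gram X p T k \<theta>) \<noteq> 0"
    and \<Omega>: "Determinant.det (Omega_opt X p T k \<theta>) > 0"
    and c: "c > 0" "\<And>h. acov \<eta> h = c * acov \<theta> h"
  shows "Lbar X p T k \<eta> = Lbar X p T k \<theta>"
proof -
  define Y where "Y = lag_data X p T k 0"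
  define Z where "Z = regressors X p T k"
  define P where "P = mat_inv (acov_mat T \<theta>)"
  define G where "G = Z\<^sup>T * (P * Z)"
  have Y: "Y \<in> carrier_mat T k" and Z: "Z \<in> carrier_mat T (1 + p * k)"
    unfolding Y_def Z_def by (rule lag_data_carrier regressors_carrier)+
  have detS: "Determinant.det (acov_mat T \<theta>) > 0" using acov_mat_woodbury(2,3)[OF T, of \<theta>] by simp
  have P: "P \<in> carrier_mat T T" unfolding P_def by (rule mat_inv_props) (use detS acov_mat_carrier in auto)
  have sc: "acov_mat T \<eta> = c \<cdot>\<^sub>m acov_mat T \<theta>" by (auto simp: acov_mat_def c(2))
  have P\<eta>: "mat_inv (acov_mat T \<eta>) = inverse c \<cdot>\<^sub>m P"
    unfolding sc P_def by (rule mat_inv_smult[OF acov_mat_carrier]) (use detS c in auto)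
  have G: "G \<in> carrier_mat (1 + p * k) (1 + p * k)"
    by (rule carrier_matI) (simp_all add: G_def carrier_matD[OF Z])
  have LG: "lag_gram X p T k \<theta> = G" by (simp add: lag_gram_acov[OF T] G_def P_def Z_def)
  have dG: "Determinant.det G \<noteq> 0" using d by (simp add: LG)
  note N = mat_inv_props(1)[OF G dG]
  note dims [simp] = carrier_matD[OF Y] carrier_matD[OF Z] carrier_matD[OF P] carrier_matD[OF N]
  have sm1: "(a \<cdot>\<^sub>m A) * B = a \<cdot>\<^sub>m (A * B)" if "dim_col A = dim_row B" for a and A B :: "real mat"
    using that by (intro mult_smult_assoc_mat) auto
  have sm2: "A * (a \<cdot>\<^sub>m B) = a \<cdot>\<^sub>m (A * B)" if "dim_col A = dim_row B" for a and A B :: "real mat"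
    using that by (intro mult_smult_distrib) auto
  have sm3: "a \<cdot>\<^sub>m (b \<cdot>\<^sub>m A) = (a * b) \<cdot>\<^sub>m A" for a b and A :: "real mat" by (auto simp: mult.assoc)
  have G\<eta>: "Z\<^sup>T * ((inverse c \<cdot>\<^sub>m P) * Z) = inverse c \<cdot>\<^sub>m G" by (simp add: sm1 sm2 G_def)
  hence LG\<eta>: "lag_gram X p T k \<eta> = inverse c \<cdot>\<^sub>m G"
    by (simp add: lag_gram_acov[OF T] P\<eta> Z_def[symmetric])
  have NG\<eta>: "mat_inv (inverse c \<cdot>\<^sub>m G) = c \<cdot>\<^sub>m mat_inv G"
    using mat_inv_smult[OF G dG, of "inverse c"] c by simp
  define R where "R = Y\<^sup>T * (P * Y) - Y\<^sup>T * (P * (Z * (mat_inv G * (Z\<^sup>T * (P * Y)))))"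
  have R: "R \<in> carrier_mat k k" by (rule carrier_matI) (simp_all add: R_def)
  have O1: "Omega_opt X p T k \<theta> = (1 / real T) \<cdot>\<^sub>m R"
    by (simp add: Omega_opt_acov[OF T d] R_def G_def Y_def Z_def P_def)
  have "Determinant.det (lag_gram X p T k \<eta>) \<noteq> 0" using dG c by (simp add: LG\<eta>)
  \<comment> \<open>In the projection term \<open>P\<close> occurs twice and the inverse of
    \<open>G\<close> once: two factors \<open>inverse c\<close> and one factor \<open>c\<close>
    leave a single \<open>inverse c\<close>.\<close>
  from Omega_opt_acov[OF T this]
  have "Omega_opt X p T k \<eta> = (1 / real T) \<cdot>\<^sub>m (inverse c \<cdot>\<^sub>m (Y\<^sup>T * (P * Y))
     - inverse c \<cdot>\<^sub>m (Y\<^sup>T * (P * (Z * (mat_inv G * (Z\<^sup>T * (P * Y)))))))"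
    using c by (simp add: P\<eta> Y_def[symmetric] Z_def[symmetric] sm1 sm2 sm3 G\<eta> NG\<eta> flip: G_def)
  also have "\<dots> = inverse c \<cdot>\<^sub>m ((1 / real T) \<cdot>\<^sub>m R)"
    by (intro eq_matI) (auto simp: R_def algebra_simps)
  finally have O2: "Omega_opt X p T k \<eta> = inverse c \<cdot>\<^sub>m Omega_opt X p T k \<theta>" by (simp add: O1)
  have dk: "dim_col (Omega_opt X p T k \<theta>) = k" using R by (simp add: O1)
  have 1: "ln (Determinant.det (Omega_opt X p T k \<eta>))
      = ln (Determinant.det (Omega_opt X p T k \<theta>)) - real k * ln c"
    using c \<Omega> by (simp add: O2 dk ln_mult ln_realpow ln_inverse)
  have "Determinant.det (gram_lambda T \<eta>) = c ^ T * Determinant.det (gram_lambda T \<theta>)"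
    using acov_mat_woodbury(2)[OF T, of \<eta>] acov_mat_woodbury(2)[OF T, of \<theta>] sc
    by (simp add: acov_mat_def)
  hence 2: "ln (Determinant.det (gram_lambda T \<eta>))
      = ln (Determinant.det (gram_lambda T \<theta>)) + real T * ln c"
    using c acov_mat_woodbury(3)[OF T, of \<theta>] by (simp add: ln_mult ln_realpow)
  show ?thesis by (simp add: Lbar_def 1 2 algebra_simps)
qed

section \<open>Differentiability of the likelihood\<close>

text \<open>Differentiability passes through the matrix operations in the order of the definitions;
  the inverses and logarithms meet nonzero, respectively positive, determinants. The second part
  says that these conditions are open, so that scaling invariance applies near \<theta> and not only
  at it.\<close>

lemma Lbar_differentiable:
  fixes \<theta> :: "real^'q::{finite,linorder}"
  assumes T: "T \<ge> CARD('q)" and d: "lik_defined X p T k \<theta>"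
  shows "Lbar X p T k differentiable (at \<theta>)"
    and "\<forall>\<^sub>F \<eta> in nhds \<theta>. Determinant.det (lag_gram X p T k \<eta>) \<noteq> 0 \<and>
       Determinant.det (Omega_opt X p T k \<eta>) > 0"
proof -
  let ?q = "CARD('q)"
  have dG: "Determinant.det (lag_gram X p T k \<theta>) \<noteq> 0"
    using d det_nonzero_if_invertible[OF lag_gram_carrier[of X p T k \<theta>]] by (auto simp: lik_defined_def)
  have dO: "Determinant.det (Omega_opt X p T k \<theta>) > 0"
    using d pos_definite_det_pos by (auto simp: lik_defined_def)
  have 1: "mat_differentiable (Theta_mat T) T T \<theta>"
    unfolding mat_differentiable_def
  proof (intro conjI allI impI)
    fix i j assume "i < T" "j < T"
    thus "(\<lambda>\<eta>. Theta_mat T \<eta> $$ (i, j)) differentiable (at \<theta>)"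
      by (cases "j \<le> i") (auto simp: Theta_mat_def ma_coeff_differentiable)
  qed (simp add: Theta_mat_carrier)
  have 2: "mat_differentiable (\<lambda>\<eta>. mat_inv (Theta_mat T \<eta>)) T T \<theta>"
    by (rule mat_differentiable_mat_inv[OF 1]) (simp add: det_Theta_mat)
  have 3: "mat_differentiable (\<lambda>\<eta> :: real^'q::{finite,linorder}. Theta_star_ext T \<eta>) T ?q \<theta>"
    unfolding mat_differentiable_def
  proof (intro conjI allI impI)
    fix i j assume "i < T" "j < ?q"
    thus "(\<lambda>\<eta> :: real^'q::{finite,linorder}. Theta_star_ext T \<eta> $$ (i, j)) differentiable (at \<theta>)"
      by (cases "i \<le> j") (simp_all add: Theta_star_ext_index[OF T] ma_coeff_differentiable)
  qed (simp add: Theta_star_ext_carrier[OF T])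
  have 4: "mat_differentiable (\<lambda>\<eta> :: real^'q::{finite,linorder}. lambda_mat T \<eta>) T ?q \<theta>"
    unfolding lambda_mat_def by (rule mat_differentiable_mult[OF 2 3])
  have 5: "mat_differentiable (\<lambda>\<eta> :: real^'q::{finite,linorder}. gram_lambda T \<eta>) ?q ?q \<theta>"
    unfolding gram_lambda_def
    by (intro mat_differentiable_mult[OF mat_differentiable_transpose 4] mat_differentiable_add 4
        mat_differentiable_const) auto
  have 6: "mat_differentiable (\<lambda>\<eta> :: real^'q::{finite,linorder}. mat_inv (gram_lambda T \<eta>)) ?q ?q \<theta>"
    by (rule mat_differentiable_mat_inv[OF 5]) (use acov_mat_woodbury(3)[OF T, of \<theta>] in simp)
  have 7: "mat_differentiable (\<lambda>\<eta> :: real^'q::{finite,linorder}. K_mat T \<eta>) T T \<theta>"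
    unfolding K_mat_def
    by (intro mat_differentiable_diff mat_differentiable_const
        mat_differentiable_mult[OF mat_differentiable_mult[OF 4 6]] mat_differentiable_transpose 4) auto
  have 8: "mat_differentiable (X_theta X p T k) T k \<theta>"
    unfolding X_theta_def
    by (intro mat_differentiable_mult[OF 2] mat_differentiable_const lag_data_carrier)
  have 9: "mat_differentiable (X_theta_lag X p T k) T (1 + p * k) \<theta>"
    unfolding X_theta_lag_def
    by (intro mat_differentiable_mult[OF 2] mat_differentiable_const regressors_carrier)
  note t8 = mat_differentiable_transpose[OF 8] and t9 = mat_differentiable_transpose[OF 9]
  have 10: "mat_differentiable (lag_gram X p T k) (1 + p * k) (1 + p * k) \<theta>"
    unfolding lag_gram_def by (rule mat_differentiable_mult[OF mat_differentiable_mult[OF t9 7] 9])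
  have 11: "mat_differentiable (\<lambda>\<eta>. mat_inv (lag_gram X p T k \<eta>)) (1 + p * k) (1 + p * k) \<theta>"
    by (rule mat_differentiable_mat_inv[OF 10 dG])
  note YK = mat_differentiable_mult[OF t8 7]
  have 12: "mat_differentiable (Omega_opt X p T k) k k \<theta>"
    unfolding Omega_opt_def Let_def
    by (rule mat_differentiable_smult[OF differentiable_const mat_differentiable_diff[OF
        mat_differentiable_mult[OF YK 8]
        mat_differentiable_mult[OF mat_differentiable_mult[OF mat_differentiable_mult[OF
          mat_differentiable_mult[OF mat_differentiable_mult[OF YK 9] 11] t9] 7] 8]]])
  note dd = mat_differentiable_det[OF 10] mat_differentiable_det[OF 12] mat_differentiable_det[OF 5]
  have ln_diff: "(\<lambda>x. ln (f x)) differentiable (at \<theta>)"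
    if "f differentiable (at \<theta>)" "f \<theta> > 0" for f :: "real^'q::{finite,linorder} \<Rightarrow> real"
    using that by (auto simp: differentiable_def intro: has_derivative_ln)
  show "Lbar X p T k differentiable (at \<theta>)"
    unfolding Lbar_def [abs_def]
    using ln_diff[OF dd(2) dO] ln_diff[OF dd(3) acov_mat_woodbury(3)[OF T]]
    by (intro differentiable_diff differentiable_mult differentiable_const)
  have "isCont (\<lambda>\<eta>. Determinant.det (lag_gram X p T k \<eta>)) \<theta>"
    "isCont (\<lambda>\<eta>. Determinant.det (Omega_opt X p T k \<eta>)) \<theta>"
    using dd by (auto intro: differentiable_imp_continuous_within)
  hence "\<forall>\<^sub>F \<eta> in at \<theta>. Determinant.det (lag_gram X p T k \<eta>) \<noteq> 0"
    "\<forall>\<^sub>F \<eta> in at \<theta>. Determinant.det (Omega_opt X p T k \<eta>) > 0"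
    using dG dO by (auto simp: continuous_at intro: tendsto_imp_eventually_ne order_tendstoD)
  thus "\<forall>\<^sub>F \<eta> in nhds \<theta>. Determinant.det (lag_gram X p T k \<eta>) \<noteq> 0 \<and>
       Determinant.det (Omega_opt X p T k \<eta>) > 0"
    using dG dO by (auto simp: eventually_nhds_conv_at eventually_conj_iff)
qed

subsection \<open>Continuous branches of the roots\<close>

text \<open>Identities obtained by substituting \<open>inverse z\<close> are available only at
  nonzero points, which still determine a polynomial.\<close>

lemma poly_eq_if_eq_off_0:
  fixes p r :: "complex poly"
  assumes "\<And>z. z \<noteq> 0 \<Longrightarrow> poly p z = poly r z"
  shows "p = r"
proof (rule ccontr)
  assume "p \<noteq> r"
  hence "finite {z. poly (p - r) z = 0}" by (intro poly_roots_finite) simp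
  moreover have "UNIV - {0} \<subseteq> {z. poly (p - r) z = 0}" using assms by auto
  ultimately have "finite (UNIV - {0 :: complex})" by (rule rev_finite_subset)
  thus False by (simp add: infinite_UNIV_char_0)
qed

section \<open>Coefficient vectors and their polynomials\<close>

lemma coeff_ma_poly: "coeff (ma_poly \<theta>) n = complex_of_real (ma_coeff \<theta> n)"
  for \<theta> :: "real^'q::{finite,linorder}"
proof -
  have "coeff (ma_poly \<theta>) n
    = (\<Sum>m\<le>CARD('q). if m = n then complex_of_real (ma_coeff \<theta> m) else 0)"
    unfolding ma_poly_def by (simp add: coeff_sum)
  also have "\<dots> = complex_of_real (ma_coeff \<theta> n)"
    by (simp add: ma_coeff_def)
  finally show ?thesis .
qed

text \<open>The position \<open>n\<close> is the same for all vectors, so a coordinate function can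
  be treated as a coefficient function when differentiating.\<close>

lemma vec_nth_eq_ma_coeff:
  fixes i :: "'q::{finite,linorder}"
  obtains n where "1 \<le> n" "n \<le> CARD('q)" "\<And>\<theta>. \<theta> $ i = ma_coeff \<theta> n"
proof -
  let ?xs = "sorted_list_of_set (UNIV :: 'q set)"
  have "i \<in> set ?xs" by simp
  then obtain m where "m < length ?xs" "?xs ! m = i" by (metis in_set_conv_nth)
  thus ?thesis by (intro that[of "Suc m"]) (auto simp: ma_coeff_def)
qed

lemma ma_coeff_eq_vec_nth:
  assumes "1 \<le> n" "n \<le> CARD('q)"
  obtains i where "\<And>\<theta> :: real^'q::{finite,linorder}. ma_coeff \<theta> n = \<theta> $ i"
  using assms by (auto simp: ma_coeff_def)

lemma ma_poly_inject:
  fixes \<theta> \<eta> :: "real^'q::{finite,linorder}"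
  shows "ma_poly \<theta> = ma_poly \<eta> \<Longrightarrow> \<theta> = \<eta>"
proof -
  assume "ma_poly \<theta> = ma_poly \<eta>"
  hence eq: "ma_coeff \<theta> n = ma_coeff \<eta> n" for n
    using coeff_ma_poly[of \<theta> n] coeff_ma_poly[of \<eta> n] by simp
  show ?thesis
  unfolding Finite_Cartesian_Product.vec_eq_iff
  proof
    fix i
    obtain n where "\<And>\<theta> :: real^'q::{finite,linorder}. \<theta> $ i = ma_coeff \<theta> n"
      using vec_nth_eq_ma_coeff[of i] by blast
    thus "\<theta> $ i = \<eta> $ i" using eq by simp
  qed
qed

lemma ma_poly_surj:
  assumes "degree P \<le> CARD('q)" "coeff P 0 = 1" "\<And>n. coeff P n \<in> \<real>"
  obtains \<eta> :: "real^'q::{finite,linorder}" where "ma_poly \<eta> = P"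
proof -
  let ?xs = "sorted_list_of_set (UNIV :: 'q set)"
  \<comment> \<open>The inverse of the increasing enumeration of the index type, well determined
    because the list is distinct.\<close>
  define pos where "pos i = (SOME m. m < CARD('q) \<and> ?xs ! m = i)" for i
  have pos: "pos (?xs ! m) = m" if "m < CARD('q)" for m
  proof -
    have "pos (?xs ! m) < CARD('q) \<and> ?xs ! pos (?xs ! m) = ?xs ! m"
      unfolding pos_def by (rule someI[of _ m]) (use that in simp)
    thus ?thesis using that nth_eq_iff_index_eq[of ?xs "pos (?xs ! m)" m] by simp
  qed
  define \<eta> :: "real^'q::{finite,linorder}" where "\<eta> = (\<chi> i. Re (coeff P (Suc (pos i))))"
  have "ma_poly \<eta> = P"
  proof (rule poly_eqI)
    fix n
    have "complex_of_real (Re (coeff P m)) = coeff P m" for m using assms(3)[of m] by simp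
    thus "coeff (ma_poly \<eta>) n = coeff P n"
      using assms(1,2) pos[of "n - 1"]
      by (auto simp: coeff_ma_poly ma_coeff_def \<eta>_def coeff_eq_0)
  qed
  thus ?thesis by (rule that)
qed

text \<open>\<open>z\<^sup>q \<theta>(1/z)\<close>, monic of degree \<open>q\<close> with the \<open>\<lambda>\<^sub>l\<close> as its roots. Unlike
  \<open>reflect_poly (ma_poly \<theta>)\<close>, it keeps the roots \<open>\<lambda>\<^sub>l = 0\<close>.\<close>

definition ma_rev :: "real ^ 'q::{finite, linorder} \<Rightarrow> complex poly" where
  "ma_rev \<theta> = (\<Sum>n\<le>CARD('q). monom (complex_of_real (ma_coeff \<theta> n)) (CARD('q) - n))"

lemma coeff_ma_rev: "coeff (ma_rev (\<theta> :: real^'q::{finite,linorder})) n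
  = (if n \<le> CARD('q) then complex_of_real (ma_coeff \<theta> (CARD('q) - n)) else 0)"
proof -
  have "coeff (ma_rev \<theta>) n
    = (\<Sum>m\<le>CARD('q). if m = CARD('q) - n \<and> n \<le> CARD('q) then complex_of_real (ma_coeff \<theta> m) else 0)"
    unfolding ma_rev_def coeff_sum by (intro sum.cong) auto
  also have "\<dots> = (if n \<le> CARD('q) then complex_of_real (ma_coeff \<theta> (CARD('q) - n)) else 0)"
    by auto
  finally show ?thesis .
qed

lemma degree_ma_rev: "degree (ma_rev (\<theta> :: real^'q::{finite,linorder})) = CARD('q)"
  by (intro antisym degree_le le_degree) (auto simp: coeff_ma_rev)

lemma lead_coeff_ma_rev: "lead_coeff (ma_rev \<theta>) = 1"
  by (simp add: degree_ma_rev coeff_ma_rev)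

lemma poly_ma_rev: "poly (ma_rev (\<theta> :: real^'q::{finite,linorder})) z
  = (\<Sum>n\<le>CARD('q). complex_of_real (ma_coeff \<theta> n) * z ^ (CARD('q) - n))"
  by (simp add: ma_rev_def poly_sum poly_monom)

lemma poly_ma_rev_inverse:
  assumes "z \<noteq> 0"
  shows "poly (ma_rev (\<theta> :: real^'q::{finite,linorder})) z = z ^ CARD('q) * poly (ma_poly \<theta>) (inverse z)"
  using assms
  by (auto simp: poly_ma_rev ma_poly_def poly_sum poly_monom sum_distrib_left power_diff
      field_simps power_inverse intro!: sum.cong)

text \<open>The two products correspond under reversal of polynomials of formal degree
  \<open>CARD('q)\<close>. Since this degree is fixed, vanishing \<open>f l\<close> are covered as
  well.\<close>

lemma ma_rev_eq_iff:
  fixes f :: "nat \<Rightarrow> complex" and \<theta> :: "real^'q::{finite,linorder}"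
  shows "ma_rev \<theta> = (\<Prod>l\<in>{1..CARD('q)}. [:- f l, 1:]) \<longleftrightarrow> ma_poly \<theta> = (\<Prod>l\<in>{1..CARD('q)}. [:1, - f l:])"
proof -
  have *: "poly (\<Prod>l\<in>{1..CARD('q)}. [:- f l, 1:]) z
      = z ^ CARD('q) * poly (\<Prod>l\<in>{1..CARD('q)}. [:1, - f l:]) (inverse z)" if "z \<noteq> 0" for z
  proof -
    have "(\<Prod>l\<in>{1..CARD('q)}. z - f l) = (\<Prod>l\<in>{1..CARD('q)}. z * (1 - inverse z * f l))"
      using that by (intro prod.cong) (auto simp: field_simps)
    thus ?thesis by (simp add: poly_prod prod.distrib)
  qed
  show ?thesis
  proof
    assume L: "ma_rev \<theta> = (\<Prod>l\<in>{1..CARD('q)}. [:- f l, 1:])"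
    show "ma_poly \<theta> = (\<Prod>l\<in>{1..CARD('q)}. [:1, - f l:])"
    proof (rule poly_eq_if_eq_off_0)
      fix z :: complex assume "z \<noteq> 0"
      thus "poly (ma_poly \<theta>) z = poly (\<Prod>l\<in>{1..CARD('q)}. [:1, - f l:]) z"
        using poly_ma_rev_inverse[of "inverse z" \<theta>] *[of "inverse z"] L by simp
    qed
  next
    assume "ma_poly \<theta> = (\<Prod>l\<in>{1..CARD('q)}. [:1, - f l:])"
    thus "ma_rev \<theta> = (\<Prod>l\<in>{1..CARD('q)}. [:- f l, 1:])"
      using * by (intro poly_eq_if_eq_off_0) (simp add: poly_ma_rev_inverse)
  qed
qed

text \<open>The polynomial is monic of degree \<open>CARD('q)\<close>, so its modulus at
  \<open>z\<close> is the product of the distances from \<open>z\<close> to the roots; if all were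
  at least \<open>e\<close>, it would be at least \<open>e ^ CARD('q)\<close>.\<close>

lemma ma_rev_near_root:
  fixes \<theta> :: "real^'q::{finite,linorder}"
  assumes "cmod (poly (ma_rev \<theta>) z) < e ^ CARD('q)" "e > 0"
  obtains w where "poly (ma_rev \<theta>) w = 0" "cmod (z - w) < e"
proof -
  obtain root where r: "Polynomial.smult (lead_coeff (ma_rev \<theta>)) (\<Prod>i<degree (ma_rev \<theta>). [:- root i, 1:]) = ma_rev \<theta>"
    by (rule complex_poly_decompose')
  hence r: "ma_rev \<theta> = (\<Prod>i<CARD('q). [:- root i, 1:])"
    by (simp add: lead_coeff_ma_rev) (simp add: degree_ma_rev)
  have "\<exists>i<CARD('q). cmod (z - root i) < e"
  proof (rule ccontr)
    assume "\<not> ?thesis"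
    hence "e \<le> cmod (z - root i)" if "i < CARD('q)" for i using that by force
    hence "(\<Prod>i<CARD('q). e) \<le> (\<Prod>i<CARD('q). cmod (z - root i))"
      using assms(2) by (intro prod_mono) auto
    also have "\<dots> = cmod (poly (ma_rev \<theta>) z)" by (simp add: r poly_prod flip: prod_norm)
    finally show False using assms(1) by simp
  qed
  then obtain i where "i < CARD('q)" "cmod (z - root i) < e" by blast
  thus ?thesis by (intro that[of "root i"]) (auto simp: r poly_prod)
qed

lemma ma_poly_root_in_family:
  fixes \<theta> :: "real^'q::{finite,linorder}"
  assumes "ma_poly \<theta> = (\<Prod>l\<in>{1..CARD('q)}. [:1, - f l:])"
  shows "poly (ma_rev \<theta>) w = 0 \<longleftrightarrow> (\<exists>l\<in>{1..CARD('q)}. w = f l)"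
  using assms unfolding ma_rev_eq_iff[symmetric] by (simp add: poly_prod)

text \<open>Two monic polynomials of degree \<open>CARD('q)\<close> that agree at
  \<open>CARD('q)\<close> distinct points are equal.\<close>

lemma ma_poly_eq_prod_distinct_roots:
  fixes \<theta> :: "real^'q::{finite,linorder}"
  assumes "inj_on f {1..CARD('q)}" "\<And>l. l \<in> {1..CARD('q)} \<Longrightarrow> poly (ma_rev \<theta>) (f l) = 0"
  shows "ma_poly \<theta> = (\<Prod>l\<in>{1..CARD('q)}. [:1, - f l:])"
proof -
  let ?P = "\<Prod>l\<in>{1..CARD('q)}. [:- f l, 1:]"
  have d: "degree ?P = CARD('q)" by (subst degree_prod_eq_sum_degree) auto
  have l: "lead_coeff ?P = 1" by (simp add: lead_coeff_prod)
  have "ma_rev \<theta> = ?P"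
  proof (rule poly_eqI_degree_lead_coeff[where n = "CARD('q)" and A = "f ` {1..CARD('q)}"])
    show "coeff (ma_rev \<theta>) CARD('q) = coeff ?P CARD('q)"
      using l lead_coeff_ma_rev[of \<theta>] by (simp only: d degree_ma_rev)
  qed (use assms in \<open>auto simp: card_image degree_ma_rev d[unfolded One_nat_def] poly_prod intro!: bexI\<close>)
  thus ?thesis by (simp only: ma_rev_eq_iff)
qed

lemma finite_separation:
  fixes f :: "nat \<Rightarrow> complex"
  assumes "finite A" "inj_on f A"
  obtains e where "e > 0"
    "\<And>l m w. l \<in> A \<Longrightarrow> m \<in> A \<Longrightarrow> cmod (f l - w) < e \<Longrightarrow> cmod (f m - w) < e \<Longrightarrow> l = m"
proof -
  \<comment> \<open>The element 1 keeps the set nonempty when \<open>A\<close> has at most one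
    element.\<close>
  define D where "D = insert 1 ((\<lambda>(l, m). cmod (f l - f m)) ` {(l, m) \<in> A \<times> A. l \<noteq> m})"
  have D: "finite D" "D \<noteq> {}" unfolding D_def using assms(1)
    by (auto intro!: finite_imageI finite_subset[OF _ finite_cartesian_product[of A A]])
  have pos: "Min D > 0" using D assms(2) by (auto simp: D_def inj_on_def)
  show ?thesis
  proof (rule that[of "Min D / 2"])
    fix l m w assume *: "l \<in> A" "m \<in> A" "cmod (f l - w) < Min D / 2" "cmod (f m - w) < Min D / 2"
    have "cmod (f l - f m) < Min D"
      using *(3,4) norm_triangle_ineq4[of "f l - w" "f m - w"] by simp
    moreover have "Min D \<le> cmod (f l - f m)" if "l \<noteq> m"
      using D * that by (intro Min_le) (auto simp: D_def)
    ultimately show "l = m" by fastforce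
  qed (use pos in simp)
qed

section \<open>Existence of continuous roots and of the root inversion\<close>

lemma continuous_poly_ma_rev: "continuous_on UNIV (\<lambda>\<eta>. poly (ma_rev \<eta>) z)"
proof -
  have "continuous_on UNIV (\<lambda>\<eta> :: real^'q::{finite,linorder}. ma_coeff \<eta> n)" for n
    using ma_coeff_differentiable
    by (auto simp: continuous_on_eq_continuous_at intro: differentiable_imp_continuous_within)
  thus ?thesis unfolding poly_ma_rev by (intro continuous_intros)
qed

text \<open>For coefficients near \<theta>, each of the disjoint discs of radius \<open>e\<close>
  about the \<open>lam l\<close> contains exactly one root, and this root is the branch. The last
  two conclusions record this, so that a root can be recognised by its location.\<close>

lemma exists_continuous_roots:
  fixes \<theta> :: "real^'q::{finite,linorder}"
  assumes "inj_on lam {1..CARD('q)}" and \<theta>: "ma_poly \<theta> = (\<Prod>l\<in>{1..CARD('q)}. [:1, - lam l:])"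
  obtains U \<Lambda> e where "open U" "\<theta> \<in> U" "e > 0"
    "\<And>l. l \<in> {1..CARD('q)} \<Longrightarrow> continuous_on U (\<Lambda> l)"
    "\<And>l. l \<in> {1..CARD('q)} \<Longrightarrow> \<Lambda> l \<theta> = lam l"
    "\<And>\<eta>. \<eta> \<in> U \<Longrightarrow> ma_poly \<eta> = (\<Prod>l\<in>{1..CARD('q)}. [:1, - \<Lambda> l \<eta>:])"
    "\<And>l \<eta>. l \<in> {1..CARD('q)} \<Longrightarrow> \<eta> \<in> U \<Longrightarrow> cmod (lam l - \<Lambda> l \<eta>) < e"
    "\<And>l \<eta> w. l \<in> {1..CARD('q)} \<Longrightarrow> \<eta> \<in> U \<Longrightarrow> poly (ma_rev \<eta>) w = 0 \<Longrightarrow> cmod (lam l - w) < e \<Longrightarrow> w = \<Lambda> l \<eta>"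
proof -
  let ?L = "{1..CARD('q)}"
  obtain e where e: "e > 0"
    "\<And>l m w. l \<in> ?L \<Longrightarrow> m \<in> ?L \<Longrightarrow> cmod (lam l - w) < e \<Longrightarrow> cmod (lam m - w) < e \<Longrightarrow> l = m"
    using finite_separation[OF _ assms(1)] by blast
  \<comment> \<open>Smallness of the polynomial at \<open>lam l\<close> forces a root within
    \<open>e\<close> of it.\<close>
  define U where "U = (\<Inter>l\<in>?L. {\<eta> :: real^'q::{finite,linorder}. cmod (poly (ma_rev \<eta>) (lam l)) < e ^ CARD('q)})"
  have openball: "open {\<eta> :: real^'q::{finite,linorder}. cmod (poly (ma_rev \<eta>) z) < r}" for z r
    by (intro open_Collect_less continuous_intros continuous_poly_ma_rev)
  have "open U" unfolding U_def by (intro open_INT ballI openball) simp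
  have "poly (ma_rev \<theta>) (lam l) = 0" if "l \<in> ?L" for l
    using ma_poly_root_in_family[OF \<theta>] that by blast
  hence "\<theta> \<in> U" using e(1) by (simp add: U_def)
  define \<Lambda> where "\<Lambda> l \<eta> = (SOME w. poly (ma_rev \<eta>) w = 0 \<and> cmod (lam l - w) < e)" for l and \<eta> :: "real^'q::{finite,linorder}"
  have \<Lambda>: "poly (ma_rev \<eta>) (\<Lambda> l \<eta>) = 0 \<and> cmod (lam l - \<Lambda> l \<eta>) < e" if "\<eta> \<in> U" "l \<in> ?L" for l \<eta>
    unfolding \<Lambda>_def
  proof (rule someI_ex)
    have "cmod (poly (ma_rev \<eta>) (lam l)) < e ^ CARD('q)" using that by (auto simp: U_def)
    from ma_rev_near_root[OF this e(1)]
    show "\<exists>w. poly (ma_rev \<eta>) w = 0 \<and> cmod (lam l - w) < e" by metis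
  qed
  have fac: "ma_poly \<eta> = (\<Prod>l\<in>?L. [:1, - \<Lambda> l \<eta>:])" if "\<eta> \<in> U" for \<eta>
  proof (rule ma_poly_eq_prod_distinct_roots)
    show "inj_on (\<lambda>l. \<Lambda> l \<eta>) ?L"
    proof (rule inj_onI)
      fix l m assume "l \<in> ?L" "m \<in> ?L" "\<Lambda> l \<eta> = \<Lambda> m \<eta>"
      thus "l = m" using \<Lambda>[OF that, of l] \<Lambda>[OF that, of m] e(2)[of l m "\<Lambda> l \<eta>"] by simp
    qed
  qed (use \<Lambda>[OF that] in auto)
  have uniq: "w = \<Lambda> l \<eta>" if *: "l \<in> ?L" "\<eta> \<in> U" "poly (ma_rev \<eta>) w = 0" "cmod (lam l - w) < e" for l \<eta> w
  proof -
    obtain m where m: "m \<in> ?L" "w = \<Lambda> m \<eta>"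
      using *(3) ma_poly_root_in_family[OF fac[OF *(2)]] by blast
    have "l = m" by (rule e(2)[OF *(1) m(1) *(4)]) (use \<Lambda>[OF *(2) m(1)] m(2) in simp)
    thus ?thesis using m(2) by simp
  qed
  have cont: "continuous_on U (\<Lambda> l)" if l: "l \<in> ?L" for l
    unfolding continuous_on_eq_continuous_at[OF \<open>open U\<close>]
  proof (intro ballI)
    fix \<eta> assume \<eta>: "\<eta> \<in> U"
    show "isCont (\<Lambda> l) \<eta>"
      unfolding isCont_def
    proof (rule tendstoI)
      fix r :: real assume "r > 0"
      \<comment> \<open>A root within \<open>d\<close> of the old branch value still lies in the
        disc about \<open>lam l\<close>, so by uniqueness it is the new branch value; it is also
        within \<open>r\<close> of the old one.\<close>
      define d where "d = min r (e - cmod (lam l - \<Lambda> l \<eta>))"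
      have "d > 0" using \<open>r > 0\<close> \<Lambda>[OF \<eta> l] by (simp add: d_def)
      define V where "V = U \<inter> {\<eta>'. cmod (poly (ma_rev \<eta>') (\<Lambda> l \<eta>)) < d ^ CARD('q)}"
      have "open V" "\<eta> \<in> V" using \<open>open U\<close> openball \<eta> \<Lambda>[OF \<eta> l] \<open>d > 0\<close> by (auto simp: V_def)
      moreover have "dist (\<Lambda> l \<eta>') (\<Lambda> l \<eta>) < r" if "\<eta>' \<in> V" for \<eta>'
      proof -
        have "cmod (poly (ma_rev \<eta>') (\<Lambda> l \<eta>)) < d ^ CARD('q)" using that by (simp add: V_def)
        then obtain w where w: "poly (ma_rev \<eta>') w = 0" "cmod (\<Lambda> l \<eta> - w) < d"
          by (rule ma_rev_near_root[OF _ \<open>d > 0\<close>])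
        have "cmod (lam l - w) \<le> cmod (lam l - \<Lambda> l \<eta>) + cmod (\<Lambda> l \<eta> - w)"
          using norm_triangle_ineq[of "lam l - \<Lambda> l \<eta>" "\<Lambda> l \<eta> - w"] by simp
        also have "\<dots> < e" using w(2) by (simp add: d_def)
        finally have "w = \<Lambda> l \<eta>'" using that w(1) l by (intro uniq) (auto simp: V_def)
        thus ?thesis using w(2) by (simp add: d_def dist_norm norm_minus_commute)
      qed
      ultimately show "\<forall>\<^sub>F \<eta>' in at \<eta>. dist (\<Lambda> l \<eta>') (\<Lambda> l \<eta>) < r"
        unfolding eventually_at_topological by blast
    qed
  qed
  have at: "\<Lambda> l \<theta> = lam l" if "l \<in> ?L" for l
    using uniq[OF that \<open>\<theta> \<in> U\<close>, of "lam l"] ma_poly_root_in_family[OF \<theta>, of "lam l"] that e(1)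
    by fastforce
  show ?thesis
    by (rule that[of U e \<Lambda>]) (use \<open>open U\<close> \<open>\<theta> \<in> U\<close> e(1) cont at fac \<Lambda> uniq in blast)+
qed

text \<open>A single product over one family of roots, the form in which the lemmas on root families
  apply.\<close>

lemma inverted_prod:
  fixes f :: "nat \<Rightarrow> complex"
  assumes "S \<subseteq> A" "finite A"
  shows "(\<Prod>l\<in>A - S. [:1, - f l:]) * (\<Prod>l\<in>S. [:1, - inverse (f l):])
    = (\<Prod>l\<in>A. [:1, - (if l \<in> S then inverse (f l) else f l):])"
proof -
  have "(\<Prod>l\<in>A. [:1, - (if l \<in> S then inverse (f l) else f l):])
    = (\<Prod>l\<in>A - S. [:1, - (if l \<in> S then inverse (f l) else f l):])
      * (\<Prod>l\<in>S. [:1, - (if l \<in> S then inverse (f l) else f l):])"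
    by (rule prod.subset_diff[OF assms])
  also have "(\<Prod>l\<in>A - S. [:1, - (if l \<in> S then inverse (f l) else f l):]) = (\<Prod>l\<in>A - S. [:1, - f l:])"
    by (intro prod.cong) auto
  finally show ?thesis by simp
qed

text \<open>What needs proof is that the inverted product has real coefficients. Conjugation
  permutes the \<open>lam l\<close> and preserves \<open>S\<close>; nearby branches follow the same
  permutation, so conjugation only reorders the inverted factors.\<close>

lemma exists_root_inversion:
  fixes \<theta> :: "real^'q::{finite,linorder}"
  assumes inj: "inj_on lam {1..CARD('q)}" and \<theta>: "ma_poly \<theta> = (\<Prod>l\<in>{1..CARD('q)}. [:1, - lam l:])"
    and S: "S \<subseteq> {1..CARD('q)}" "cnj ` lam ` S \<subseteq> lam ` S"
  shows "\<exists>IR. is_root_inversion lam S \<theta> IR"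
proof -
  let ?L = "{1..CARD('q)}"
  obtain U \<Lambda> e where U: "open U" "\<theta> \<in> U" and e: "e > 0"
    and \<Lambda>: "\<And>l. l \<in> ?L \<Longrightarrow> continuous_on U (\<Lambda> l)" "\<And>l. l \<in> ?L \<Longrightarrow> \<Lambda> l \<theta> = lam l"
    and fac: "\<And>\<eta>. \<eta> \<in> U \<Longrightarrow> ma_poly \<eta> = (\<Prod>l\<in>?L. [:1, - \<Lambda> l \<eta>:])"
    and near: "\<And>l \<eta>. l \<in> ?L \<Longrightarrow> \<eta> \<in> U \<Longrightarrow> cmod (lam l - \<Lambda> l \<eta>) < e"
    and uniq: "\<And>l \<eta> w. l \<in> ?L \<Longrightarrow> \<eta> \<in> U \<Longrightarrow> poly (ma_rev \<eta>) w = 0 \<Longrightarrow> cmod (lam l - w) < e \<Longrightarrow> w = \<Lambda> l \<eta>"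
    by (rule exists_continuous_roots[OF inj \<theta>]) blast
  have cnj_root: "poly (ma_rev \<eta>) (cnj w) = 0" if "poly (ma_rev \<eta>) w = 0" for w and \<eta> :: "real^'q::{finite,linorder}"
  proof -
    have "poly (ma_rev \<eta>) (cnj w) = cnj (poly (ma_rev \<eta>) w)" by (simp add: poly_ma_rev)
    thus ?thesis using that by simp
  qed
  have "\<exists>m\<in>?L. cnj (lam l) = lam m" if "l \<in> ?L" for l
    using cnj_root[of \<theta> "lam l"] that unfolding ma_poly_root_in_family[OF \<theta>] by blast
  then obtain \<sigma> where \<sigma>: "\<And>l. l \<in> ?L \<Longrightarrow> \<sigma> l \<in> ?L \<and> cnj (lam l) = lam (\<sigma> l)" by metis
  have \<sigma>inj: "inj_on \<sigma> ?L" using \<sigma> inj by (metis (no_types, lifting) complex_cnj_cnj inj_on_def)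
  have \<sigma>S: "\<sigma> ` S \<subseteq> S"
  proof
    fix m assume "m \<in> \<sigma> ` S"
    then obtain l where l: "l \<in> S" "m = \<sigma> l" by blast
    then obtain m' where "m' \<in> S" "cnj (lam l) = lam m'" using S(2) by blast
    thus "m \<in> S" using inj \<sigma>[of l] l S(1) by (metis inj_onD subsetD)
  qed
  have "\<sigma> ` ?L = ?L" by (rule endo_inj_surj[OF _ _ \<sigma>inj]) (use \<sigma> in auto)
  hence bij: "bij_betw \<sigma> ?L ?L" using \<sigma>inj by (simp add: bij_betw_def)
  have \<sigma>S_iff: "\<sigma> l \<in> S \<longleftrightarrow> l \<in> S" if "l \<in> ?L" for l
  proof -
    have "\<sigma> ` S = S" by (rule endo_inj_surj[OF _ \<sigma>S inj_on_subset[OF \<sigma>inj S(1)]])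
        (use finite_subset[OF S(1)] in simp)
    thus ?thesis using inj_on_image_mem_iff[OF \<sigma>inj that S(1)] by simp
  qed
  \<comment> \<open>The conjugate of a branch is again a root, as the coefficients are real, and it
    lies in the disc about \<open>lam (\<sigma> l)\<close>.\<close>
  have \<Lambda>cnj: "cnj (\<Lambda> l \<eta>) = \<Lambda> (\<sigma> l) \<eta>" if "l \<in> ?L" "\<eta> \<in> U" for l \<eta>
  proof (rule uniq)
    show "poly (ma_rev \<eta>) (cnj (\<Lambda> l \<eta>)) = 0"
      by (rule cnj_root) (use ma_poly_root_in_family[OF fac] that in blast)
    have "lam (\<sigma> l) - cnj (\<Lambda> l \<eta>) = cnj (lam l - \<Lambda> l \<eta>)" using \<sigma> that by simp
    thus "cmod (lam (\<sigma> l) - cnj (\<Lambda> l \<eta>)) < e" using near[OF that] by (simp only: complex_mod_cnj)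
  qed (use \<sigma> that in auto)
  define g where "g \<eta> l = (if l \<in> S then inverse (\<Lambda> l \<eta>) else \<Lambda> l \<eta>)" for \<eta> l
  define P where "P \<eta> = (\<Prod>l\<in>?L. [:1, - g \<eta> l:])" for \<eta>
  have "\<exists>\<eta>' :: real^'q::{finite,linorder}. ma_poly \<eta>' = P \<eta>" if \<eta>: "\<eta> \<in> U" for \<eta>
  proof -
    have gc: "cnj (g \<eta> l) = g \<eta> (\<sigma> l)" if "l \<in> ?L" for l
      using \<Lambda>cnj[OF that \<eta>] \<sigma>S_iff[OF that] by (simp add: g_def)
    have "cnj (poly (P \<eta>) (cnj z)) = poly (P \<eta>) z" for z
    proof -
      have "cnj (poly (P \<eta>) (cnj z)) = (\<Prod>l\<in>?L. 1 - z * g \<eta> (\<sigma> l))"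
        unfolding P_def poly_prod cnj_prod by (intro prod.cong) (auto simp: gc)
      also have "\<dots> = (\<Prod>l\<in>?L. 1 - z * g \<eta> l)" by (rule prod.reindex_bij_betw[OF bij])
      finally show ?thesis by (simp add: P_def poly_prod)
    qed
    hence "map_poly cnj (P \<eta>) = P \<eta>" by (simp add: fun_eq_iff flip: poly_eq_poly_eq_iff)
    hence "cnj (coeff (P \<eta>) n) = coeff (P \<eta>) n" for n by (metis coeff_map_poly complex_cnj_zero)
    hence real: "coeff (P \<eta>) n \<in> \<real>" for n by (simp add: Reals_cnj_iff)
    have one: "coeff (P \<eta>) 0 = 1" by (simp add: P_def poly_prod flip: poly_0_coeff_0)
    have "degree (P \<eta>) \<le> (\<Sum>l\<in>?L. degree [:1, - g \<eta> l:])"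
      unfolding P_def by (rule degree_prod_sum_le[unfolded o_def]) simp
    also have "\<dots> \<le> (\<Sum>l\<in>?L. 1)" by (rule sum_mono) simp
    finally have "degree (P \<eta>) \<le> CARD('q)" by simp
    from ma_poly_surj[OF this one real] show ?thesis by blast
  qed
  then obtain IR :: "real^'q::{finite,linorder} \<Rightarrow> real^'q::{finite,linorder}" where IR: "\<And>\<eta>. \<eta> \<in> U \<Longrightarrow> ma_poly (IR \<eta>) = P \<eta>" by metis
  have "is_root_inversion lam S \<theta> IR"
    unfolding is_root_inversion_def
    by (intro exI[of _ U] exI[of _ \<Lambda>] conjI ballI)
      (use U \<Lambda> fac IR in \<open>simp_all only: inverted_prod[OF S(1) finite_atLeastAtMost] P_def g_def\<close>)
  thus ?thesis by (rule exI[where x = IR])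
qed

subsection \<open>Root inversion at a fixed point\<close>

lemma has_derivative_zero_if_bound:
  fixes r :: "'a::real_normed_vector \<Rightarrow> 'b::real_normed_vector"
  assumes "\<And>y. norm (r y) \<le> norm (y - x) * \<psi> y" and "(\<psi> \<longlongrightarrow> 0) (at x)"
  shows "(r has_derivative (\<lambda>_. 0)) (at x)"
proof -
  have rx: "r x = 0" using assms(1)[of x] by simp
  have "((\<lambda>y. norm (r y) / norm (y - x)) \<longlongrightarrow> 0) (at x)"
  proof (rule tendsto_sandwich[OF _ _ tendsto_const assms(2)])
    show "\<forall>\<^sub>F y in at x. norm (r y) / norm (y - x) \<le> \<psi> y"
      using assms(1) by (auto simp: eventually_at_filter divide_le_eq mult.commute)
  qed simp
  thus ?thesis by (simp add: has_derivative_iff_norm rx)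
qed

text \<open>Comparing \<open>ma_rev \<eta>\<close> with \<open>ma_rev \<theta>\<close> at the point
  \<open>f \<eta>\<close> gives \<open>(f \<eta> - lam l) * D \<eta>\<close> as a combination of the
  coefficient increments \<open>d \<eta> n\<close>. Since \<open>D \<theta> \<noteq> 0\<close> by
  distinctness of the roots, continuity of \<open>f\<close> improves to differentiability.\<close>

lemma differentiable_root:
  fixes \<theta> :: "real^'q::{finite,linorder}" and f :: "real^'q::{finite,linorder} \<Rightarrow> complex"
  assumes inj: "inj_on lam {1..CARD('q)}" and \<theta>: "ma_poly \<theta> = (\<Prod>l\<in>{1..CARD('q)}. [:1, - lam l:])"
    and l: "l \<in> {1..CARD('q)}" and f: "isCont f \<theta>" "f \<theta> = lam l"
    and root: "\<forall>\<^sub>F \<eta> in nhds \<theta>. poly (ma_rev \<eta>) (f \<eta>) = 0"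
  shows "f differentiable (at \<theta>)"
proof -
  let ?L = "{1..CARD('q)}" and ?q = "CARD('q)"
  define D where "D \<eta> = (\<Prod>m\<in>?L - {l}. f \<eta> - lam m)" for \<eta>
  define d where "d \<eta> n = complex_of_real (ma_coeff \<eta> n - ma_coeff \<theta> n)" for \<eta> :: "real^'q::{finite,linorder}" and n
  define \<phi> where "\<phi> n \<eta> = - (f \<eta> ^ (?q - n) / D \<eta>)" for n \<eta>
  have Dcont: "isCont D \<theta>" unfolding D_def by (intro continuous_intros f)
  have "f \<theta> - lam m \<noteq> 0" if "m \<in> ?L - {l}" for m
    using inj_onD[OF inj, of l m] l that f(2) by auto
  hence D0: "D \<theta> \<noteq> 0" unfolding D_def by (simp only: prod_zero_iff finite_Diff finite_atLeastAtMost) blast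
  have \<phi>cont: "isCont (\<phi> n) \<theta>" for n unfolding \<phi>_def by (intro continuous_intros Dcont D0 f)
  have "\<forall>\<^sub>F \<eta> in nhds \<theta>. D \<eta> \<noteq> 0"
    using Dcont D0 by (auto simp: continuous_at eventually_nhds_conv_at intro: tendsto_imp_eventually_ne)
  hence eq: "\<forall>\<^sub>F \<eta> in nhds \<theta>. lam l + (\<Sum>n\<le>?q. d \<eta> n * \<phi> n \<eta>) = f \<eta>"
    using root
  proof eventually_elim
    case (elim \<eta>)
    have "poly (ma_rev \<theta>) (f \<eta>) = (f \<eta> - lam l) * D \<eta>"
      using \<theta> l unfolding ma_rev_eq_iff[symmetric] D_def
      by (simp add: poly_prod prod.remove[of ?L l] left_diff_distrib del: One_nat_def)
    hence "(f \<eta> - lam l) * D \<eta> = - (\<Sum>n\<le>?q. d \<eta> n * f \<eta> ^ (?q - n))"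
      using elim(2) unfolding poly_ma_rev d_def by (simp add: algebra_simps sum_subtractf)
    hence "f \<eta> - lam l = - (\<Sum>n\<le>?q. d \<eta> n * f \<eta> ^ (?q - n)) / D \<eta>" using elim(1) by (simp add: field_simps)
    thus ?case by (simp add: \<phi>_def sum_divide_distrib sum_negf algebra_simps)
  qed
  have "(\<lambda>\<eta>. d \<eta> n * \<phi> n \<eta>) differentiable (at \<theta>)" for n
  proof -
    have db: "norm (d \<eta> n) \<le> norm (\<eta> - \<theta>)" for \<eta>
    proof (cases "n = 0 \<or> n > ?q")
      case False
      then obtain i where "\<And>\<eta> :: real^'q::{finite,linorder}. ma_coeff \<eta> n = \<eta> $ i"
        using ma_coeff_eq_vec_nth[of n] by (metis Suc_leI linorder_not_less not_gr_zero One_nat_def)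
      thus ?thesis using component_le_norm_cart[of "\<eta> - \<theta>" i] by (simp add: d_def flip: of_real_diff)
    qed (auto simp: d_def ma_coeff_eq_0)
    \<comment> \<open>The increment is at most \<open>norm (\<eta> - \<theta>)\<close> and the
      second factor tends to 0, so mere continuity of \<open>\<phi> n\<close> suffices for a zero
      derivative.\<close>
    have "((\<lambda>\<eta>. d \<eta> n * (\<phi> n \<eta> - \<phi> n \<theta>)) has_derivative (\<lambda>_. 0)) (at \<theta>)"
    proof (rule has_derivative_zero_if_bound)
      show "norm (d \<eta> n * (\<phi> n \<eta> - \<phi> n \<theta>)) \<le> norm (\<eta> - \<theta>) * norm (\<phi> n \<eta> - \<phi> n \<theta>)" for \<eta>
        using db by (simp add: norm_mult mult_right_mono)
      show "((\<lambda>\<eta>. norm (\<phi> n \<eta> - \<phi> n \<theta>)) \<longlongrightarrow> 0) (at \<theta>)"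
        using \<phi>cont[of n] by (simp add: isCont_def tendsto_norm_zero_iff LIM_zero_iff)
    qed
    hence "(\<lambda>\<eta>. d \<eta> n * (\<phi> n \<eta> - \<phi> n \<theta>)) differentiable (at \<theta>)"
      unfolding differentiable_def by blast
    moreover have "(\<lambda>\<eta>. d \<eta> n) differentiable (at \<theta>)"
      unfolding d_def
      by (rule differentiable_compose[of complex_of_real])
        (intro bounded_linear_imp_differentiable[OF bounded_linear_of_real]
          differentiable_diff ma_coeff_differentiable differentiable_const)+
    ultimately have "(\<lambda>\<eta>. d \<eta> n * (\<phi> n \<eta> - \<phi> n \<theta>) + d \<eta> n * \<phi> n \<theta>) differentiable (at \<theta>)"
      by (rule differentiable_add[OF _ differentiable_mult[OF _ differentiable_const]])
    thus ?thesis by (simp add: algebra_simps)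
  qed
  hence "(\<lambda>\<eta>. lam l + (\<Sum>n\<le>?q. d \<eta> n * \<phi> n \<eta>)) differentiable (at \<theta>)"
    by (intro differentiable_add differentiable_const differentiable_sum) auto
  with eq show ?thesis by (rule differentiable_cong_nhds)
qed

lemma differentiable_coeff_prod_linear:
  fixes g :: "'i \<Rightarrow> 'a::real_normed_vector \<Rightarrow> complex"
  assumes "finite A" "\<And>l. l \<in> A \<Longrightarrow> g l differentiable (at x)"
  shows "(\<lambda>y. coeff (\<Prod>l\<in>A. [:1, - g l y:]) n) differentiable (at x)"
  using assms
proof (induction A arbitrary: n rule: finite_induct)
  case (insert a A)
  have "(\<lambda>y. coeff (\<Prod>l\<in>insert a A. [:1, - g l y:]) n) =
    (\<lambda>y. coeff (\<Prod>l\<in>A. [:1, - g l y:]) n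
      - (case n of 0 \<Rightarrow> 0 | Suc m \<Rightarrow> g a y * coeff (\<Prod>l\<in>A. [:1, - g l y:]) m))"
    using insert.hyps by (auto simp: fun_eq_iff coeff_pCons split: nat.split)
  thus ?case using insert by (cases n) auto
qed simp

text \<open>Both families list the roots of the same polynomials. Close to the limit each value lies
  in one of the disjoint discs about the \<open>lam l\<close>, and the disc decides which branch it
  is.\<close>

lemma roots_match:
  fixes lam :: "nat \<Rightarrow> complex" and f g :: "nat \<Rightarrow> 'a \<Rightarrow> complex"
  assumes inj: "inj_on lam {1..CARD('q)}" and \<pi>: "\<And>l. l \<in> {1..CARD('q)} \<Longrightarrow> \<pi> l \<in> {1..CARD('q)}"
    and f: "\<And>l. l \<in> {1..CARD('q)} \<Longrightarrow> (f l \<longlongrightarrow> lam l) F"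
    and g: "\<And>l. l \<in> {1..CARD('q)} \<Longrightarrow> (g l \<longlongrightarrow> lam (\<pi> l)) F"
    and eq: "\<forall>\<^sub>F y in F. ma_poly (h y :: real^'q::{finite,linorder}) = (\<Prod>l\<in>{1..CARD('q)}. [:1, - f l y:]) \<and>
      ma_poly (h y) = (\<Prod>l\<in>{1..CARD('q)}. [:1, - g l y:])"
  shows "\<forall>\<^sub>F y in F. \<forall>l\<in>{1..CARD('q)}. g l y = f (\<pi> l) y"
proof -
  let ?L = "{1..CARD('q)}"
  obtain e where e: "e > 0"
    "\<And>l m w. l \<in> ?L \<Longrightarrow> m \<in> ?L \<Longrightarrow> cmod (lam l - w) < e \<Longrightarrow> cmod (lam m - w) < e \<Longrightarrow> l = m"
    using finite_separation[OF _ inj] by blast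
  have "\<forall>\<^sub>F y in F. \<forall>l\<in>?L. dist (f l y) (lam l) < e"
    by (intro eventually_ball_finite ballI tendstoD[OF f]) (use e(1) in auto)
  moreover have "\<forall>\<^sub>F y in F. \<forall>l\<in>?L. dist (g l y) (lam (\<pi> l)) < e"
    by (intro eventually_ball_finite ballI tendstoD[OF g]) (use e(1) in auto)
  ultimately show ?thesis using eq
  proof eventually_elim
    case (elim y)
    show ?case
    proof
      fix l assume l: "l \<in> ?L"
      have "poly (ma_rev (h y)) (g l y) = 0"
        using ma_poly_root_in_family[OF conjunct2[OF elim(3)], of "g l y"] l by blast
      then obtain m where m: "m \<in> ?L" "g l y = f m y"
        using ma_poly_root_in_family[OF conjunct1[OF elim(3)], of "g l y"] by blast
      have "m = \<pi> l"
      proof (rule e(2)[of _ _ "g l y"])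
        show "cmod (lam m - g l y) < e" using elim(1) m by (simp add: dist_norm norm_minus_commute)
        show "cmod (lam (\<pi> l) - g l y) < e" using elim(2) l by (simp add: dist_norm norm_minus_commute)
      qed (use m \<pi> l in auto)
      thus "g l y = f (\<pi> l) y" using m by simp
    qed
  qed
qed

text \<open>The product is the autocovariance generating function multiplied by the power
  \<open>CARD('q)\<close> of the variable, hence the shift of the index.\<close>

lemma coeff_ma_poly_mult_ma_rev:
  fixes \<theta> :: "real^'q::{finite,linorder}"
  shows "coeff (ma_poly \<theta> * ma_rev \<theta>) (CARD('q) + h) = complex_of_real (acov \<theta> h)"
proof -
  let ?q = "CARD('q)"
  have "coeff (ma_poly \<theta> * ma_rev \<theta>) (?q + h)
    = (\<Sum>i\<le>?q + h. coeff (ma_poly \<theta>) i * coeff (ma_rev \<theta>) (?q + h - i))"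
    by (rule coeff_mult)
  also have "\<dots> = (\<Sum>i\<in>{h..?q + h}. complex_of_real (ma_coeff \<theta> i * ma_coeff \<theta> (i - h)))"
    by (intro sum.mono_neutral_cong_right) (auto simp: coeff_ma_poly coeff_ma_rev)
  also have "\<dots> = (\<Sum>n\<le>?q. complex_of_real (ma_coeff \<theta> n * ma_coeff \<theta> (n + h)))"
    by (intro sum.reindex_bij_witness[of _ "\<lambda>n. n + h" "\<lambda>i. i - h"]) (auto simp: mult.commute)
  finally show ?thesis by (simp add: acov_def)
qed

text \<open>Each inverted pair of factors changes by the factor \<open>inverse (f l) ^ 2\<close>.
  Their product \<open>C\<close> is a priori complex; the lag 0 autocovariances, real and positive,
  show that it is a positive real.\<close>

lemma acov_root_inversion:
  fixes \<theta> \<eta> :: "real^'q::{finite,linorder}"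
  assumes \<theta>: "ma_poly \<theta> = (\<Prod>l\<in>{1..CARD('q)}. [:1, - f l:])"
    and \<eta>: "ma_poly \<eta> = (\<Prod>l\<in>{1..CARD('q)}. [:1, - (if l \<in> S then inverse (f l) else f l):])"
    and nz: "\<And>l. l \<in> {1..CARD('q)} \<Longrightarrow> f l \<noteq> 0"
  obtains c where "c > 0" "\<And>h. acov \<eta> h = c * acov \<theta> h"
proof -
  let ?L = "{1..CARD('q)}"
  define g where "g l = (if l \<in> S then inverse (f l) else f l)" for l
  define C where "C = (\<Prod>l\<in>?L. if l \<in> S then inverse (f l) ^ 2 else 1)"
  have p: "ma_poly \<eta> = (\<Prod>l\<in>?L. [:1, - g l:])" using \<eta> by (simp only: g_def)
  hence r: "ma_rev \<eta> = (\<Prod>l\<in>?L. [:- g l, 1:])" by (simp only: ma_rev_eq_iff)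
  have "ma_poly \<eta> * ma_rev \<eta> = (\<Prod>l\<in>?L. [:1, - g l:] * [:- g l, 1:])"
    by (simp only: p r prod.distrib)
  also have "\<dots> = (\<Prod>l\<in>?L. Polynomial.smult (if l \<in> S then inverse (f l) ^ 2 else 1) ([:1, - f l:] * [:- f l, 1:]))"
  proof (rule prod.cong)
    fix l assume "l \<in> ?L"
    thus "[:1, - g l:] * [:- g l, 1:]
      = Polynomial.smult (if l \<in> S then inverse (f l) ^ 2 else 1) ([:1, - f l:] * [:- f l, 1:])"
      using nz[of l] by (auto simp: g_def field_simps power2_eq_square)
  qed simp
  also have "\<dots> = Polynomial.smult C (ma_poly \<theta> * ma_rev \<theta>)"
    using \<theta> unfolding ma_rev_eq_iff[symmetric] by (simp only: \<theta> prod_smult prod.distrib C_def)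
  finally have "complex_of_real (acov \<eta> h) = C * complex_of_real (acov \<theta> h)" for h
    by (metis coeff_ma_poly_mult_ma_rev coeff_smult)
  note C = this
  have pos: "acov \<zeta> 0 > 0" for \<zeta> :: "real^'q::{finite,linorder}"
  proof -
    \<comment> \<open>The constant coefficient 1 contributes a positive square.\<close>
    have "0 < ma_coeff \<zeta> 0 * ma_coeff \<zeta> (0 + 0)" by simp
    also have "\<dots> \<le> acov \<zeta> 0" unfolding acov_def by (rule member_le_sum) auto
    finally show ?thesis .
  qed
  define c where "c = acov \<eta> 0 / acov \<theta> 0"
  have "C = complex_of_real c" using C[of 0] pos[of \<theta>] by (simp add: c_def field_simps)
  hence "complex_of_real (acov \<eta> h) = complex_of_real (c * acov \<theta> h)" for h using C[of h] by simp
  hence "acov \<eta> h = c * acov \<theta> h" for h by (simp only: of_real_eq_iff)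
  moreover have "c > 0" using pos by (simp add: c_def)
  ultimately show ?thesis by (rule that[rotated])
qed

text \<open>Cancelling the factors outside \<open>S\<close> leaves two equal products over
  \<open>S\<close>. At the point \<open>lam l\<close> the inverted one vanishes, hence so does the
  other, and some \<open>lam m\<close> with \<open>m \<in> S\<close> is the inverse of
  \<open>lam l\<close>.\<close>

lemma fixed_inversion_perm:
  fixes lam :: "nat \<Rightarrow> complex"
  assumes S: "S \<subseteq> A" "finite A" and inj: "inj_on lam A" and nz: "\<And>l. l \<in> A \<Longrightarrow> lam l \<noteq> 0"
    and eq: "(\<Prod>l\<in>A. [:1, - lam l:]) = (\<Prod>l\<in>A. [:1, - (if l \<in> S then inverse (lam l) else lam l):])"
  obtains \<pi> where "bij_betw \<pi> S S" "\<And>l. l \<in> S \<Longrightarrow> lam (\<pi> l) = inverse (lam l)" "\<And>l. l \<notin> S \<Longrightarrow> \<pi> l = l"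
proof -
  have fin: "finite S" using S by (rule finite_subset)
  have "(\<Prod>l\<in>A - S. [:1, - lam l:]) * (\<Prod>l\<in>S. [:1, - lam l:])
      = (\<Prod>l\<in>A - S. [:1, - lam l:]) * (\<Prod>l\<in>S. [:1, - inverse (lam l):])"
    using eq inverted_prod[OF S, of lam] prod.subset_diff[OF S, of "\<lambda>l. [:1, - lam l:]"] by simp
  hence *: "(\<Prod>l\<in>S. [:1, - lam l:]) = (\<Prod>l\<in>S. [:1, - inverse (lam l):])"
    using S(2) by simp
  have "\<exists>m\<in>S. lam m = inverse (lam l)" if l: "l \<in> S" for l
  proof -
    have "poly (\<Prod>l\<in>S. [:1, - inverse (lam l):]) (lam l) = 0"
      unfolding poly_prod
    proof (rule prod_zero[OF fin], rule bexI[OF _ l])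
      have "lam l \<noteq> 0" using l nz[of l] S(1) by blast
      thus "poly [:1, - inverse (lam l):] (lam l) = 0" by simp
    qed
    hence "poly (\<Prod>l\<in>S. [:1, - lam l:]) (lam l) = 0" by (simp only: *)
    then obtain m where "m \<in> S" "lam l * lam m = 1" using fin by (auto simp: poly_prod)
    thus ?thesis by (metis inverse_unique)
  qed
  then obtain \<pi>' where \<pi>': "\<And>l. l \<in> S \<Longrightarrow> \<pi>' l \<in> S \<and> lam (\<pi>' l) = inverse (lam l)" by metis
  define \<pi> where "\<pi> l = (if l \<in> S then \<pi>' l else l)" for l
  have "inj_on \<pi> S"
  proof (rule inj_onI)
    fix l m assume *: "l \<in> S" "m \<in> S" "\<pi> l = \<pi> m"
    hence "inverse (lam l) = inverse (lam m)" using \<pi>' by (metis \<pi>_def)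
    thus "l = m" using * inj S(1) by (metis inj_onD inverse_eq_iff_eq subsetD)
  qed
  moreover from this have "\<pi> ` S = S" by (intro endo_inj_surj fin) (use \<pi>' in \<open>auto simp: \<pi>_def\<close>)
  ultimately have "bij_betw \<pi> S S" by (simp add: bij_betw_def)
  thus ?thesis by (rule that) (use \<pi>' in \<open>auto simp: \<pi>_def\<close>)
qed

lemma involution_eigenvalue:
  assumes A: "A ** A = Finite_Cartesian_Product.mat 1" and \<mu>: "complex_eigenvalue A \<mu>"
  shows "\<mu> = 1 \<or> \<mu> = -1"
proof -
  define B where "B = (\<chi> i j. complex_of_real (A $ i $ j))"
  obtain v where v: "v \<noteq> 0" "B *v v = \<mu> *s v" using \<mu> by (auto simp: complex_eigenvalue_def B_def)
  have "B ** B = Finite_Cartesian_Product.mat 1"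
    using arg_cong[OF A, of "\<lambda>M. \<chi> i j. complex_of_real (M $ i $ j)"]
    by (simp add: B_def matrix_matrix_mult_def Finite_Cartesian_Product.mat_def if_distrib cong: if_cong)
  hence "v = B *v (B *v v)" by (simp add: matrix_vector_mul_assoc)
  also have "\<dots> = (\<mu> * \<mu>) *s v" by (simp add: v(2) vector_scalar_commute vector_smult_assoc)
  finally have eq: "v = (\<mu> * \<mu>) *s v" .
  obtain i where i: "v $ i \<noteq> 0" using v(1) by (auto simp: Finite_Cartesian_Product.vec_eq_iff)
  have "v $ i = \<mu> * \<mu> * v $ i" using arg_cong[OF eq, of "\<lambda>v. v $ i"] by simp
  hence "\<mu> * \<mu> = 1" using i by simp
  thus ?thesis by (simp add: square_eq_1_iff)
qed

section \<open>Jacobian and likelihood gradient at a fixed point\<close>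

theorem lemma3:
  fixes k p T :: nat
    and \<theta> :: "real ^ 'q::{finite, linorder}"
    and lam :: "nat \<Rightarrow> complex"
    and S :: "nat set"
  assumes "k \<ge> 1"
    and "T \<ge> CARD('q)"
    and "\<And>l. l \<in> {1..CARD('q)} \<Longrightarrow> lam l \<noteq> 0"
    and "inj_on lam {1..CARD('q)}"
    and "ma_poly \<theta> = (\<Prod>l\<in>{1..CARD('q)}. [:1, - lam l:])"
    and "S \<subseteq> {1..CARD('q)}"
    and "cnj ` lam ` S \<subseteq> lam ` S"
  shows "(\<exists>IR. is_root_inversion lam S \<theta> IR) \<and>
    (\<forall>IR. is_root_inversion lam S \<theta> IR \<and> IR \<theta> = \<theta> \<longrightarrow>
       IR differentiable (at \<theta>) \<and>
       jacobian IR (at \<theta>) ** jacobian IR (at \<theta>) = Finite_Cartesian_Product.mat 1 \<and>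
       (\<forall>\<mu>. complex_eigenvalue (jacobian IR (at \<theta>)) \<mu> \<longrightarrow> \<mu> = 1 \<or> \<mu> = -1) \<and>
       (\<forall>X. lik_defined X p T k \<theta> \<longrightarrow>
          (\<exists>G. GDERIV (Lbar X p T k) \<theta> :> G \<and> G v* jacobian IR (at \<theta>) = G)))"
proof (intro conjI allI impI)
  show "\<exists>IR. is_root_inversion lam S \<theta> IR" by (rule exists_root_inversion[OF assms(4-7)])
next
  note T = assms(2) and nz = assms(3) and inj = assms(4) and \<theta> = assms(5) and S = assms(6)
  let ?L = "{1..CARD('q)}"
  fix IR assume IR: "is_root_inversion lam S \<theta> IR \<and> IR \<theta> = \<theta>"
  then obtain U \<Lambda> where U: "open U" "\<theta> \<in> U"
    and \<Lambda>cont: "\<And>l. l \<in> ?L \<Longrightarrow> continuous_on U (\<Lambda> l)" and \<Lambda>\<theta>: "\<And>l. l \<in> ?L \<Longrightarrow> \<Lambda> l \<theta> = lam l"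
    and fac: "\<And>\<eta>. \<eta> \<in> U \<Longrightarrow> ma_poly \<eta> = (\<Prod>l\<in>?L. [:1, - \<Lambda> l \<eta>:])"
    and facIR': "\<And>\<eta>. \<eta> \<in> U \<Longrightarrow> ma_poly (IR \<eta>) =
             (\<Prod>l\<in>?L - S. [:1, - \<Lambda> l \<eta>:]) * (\<Prod>l\<in>S. [:1, - inverse (\<Lambda> l \<eta>):])"
    unfolding is_root_inversion_def by blast
  define g where "g l \<eta> = (if l \<in> S then inverse (\<Lambda> l \<eta>) else \<Lambda> l \<eta>)" for l \<eta>
  have facIR: "ma_poly (IR \<eta>) = (\<Prod>l\<in>?L. [:1, - g l \<eta>:])" if "\<eta> \<in> U" for \<eta>
    using facIR'[OF that] by (simp only: inverted_prod[OF S finite_atLeastAtMost] g_def)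
  have evU: "\<forall>\<^sub>F \<eta> in nhds \<theta>. \<eta> \<in> U" using U by (rule eventually_nhds_in_open)
  have \<Lambda>isCont: "isCont (\<Lambda> l) \<theta>" if "l \<in> ?L" for l
    using \<Lambda>cont[OF that] U by (simp add: continuous_on_eq_continuous_at)
  have \<Lambda>diff: "\<Lambda> l differentiable (at \<theta>)" if l: "l \<in> ?L" for l
  proof (rule differentiable_root[OF inj \<theta> l \<Lambda>isCont[OF l] \<Lambda>\<theta>[OF l]])
    show "\<forall>\<^sub>F \<eta> in nhds \<theta>. poly (ma_rev \<eta>) (\<Lambda> l \<eta>) = 0"
      using evU by (rule eventually_mono) (use ma_poly_root_in_family[OF fac] l in blast)
  qed
  have \<Lambda>nz: "\<Lambda> l \<theta> \<noteq> 0" if "l \<in> ?L" for l using \<Lambda>\<theta> nz that by simp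
  have gdiff: "g l differentiable (at \<theta>)" if "l \<in> ?L" for l
    using \<Lambda>diff[OF that] \<Lambda>nz[OF that] by (cases "l \<in> S") (simp_all add: g_def[abs_def])
  have IRdiff: "IR differentiable (at \<theta>)"
    unfolding differentiable_componentwise_within[of IR]
  proof
    fix b :: "real^'q::{finite,linorder}" assume "b \<in> Basis"
    then obtain i where b: "b = axis i 1" by (auto simp: Basis_vec_def)
    obtain n where n: "\<And>\<theta> :: real^'q::{finite,linorder}. \<theta> $ i = ma_coeff \<theta> n"
      using vec_nth_eq_ma_coeff[of i] by blast
    \<comment> \<open>Each coordinate of \<open>IR \<eta>\<close> is a coefficient of the inverted
      product, hence differentiable in the branches.\<close>
    have "\<forall>\<^sub>F \<eta> in nhds \<theta>. Re (coeff (\<Prod>l\<in>?L. [:1, - g l \<eta>:]) n) = inner (IR \<eta>) b"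
      using evU
    proof (rule eventually_mono)
      fix \<eta> assume "\<eta> \<in> U"
      thus "Re (coeff (\<Prod>l\<in>?L. [:1, - g l \<eta>:]) n) = inner (IR \<eta>) b"
        using coeff_ma_poly[of "IR \<eta>" n] facIR[of \<eta>] by (simp add: b inner_axis n)
    qed
    moreover have "(\<lambda>\<eta>. Re (coeff (\<Prod>l\<in>?L. [:1, - g l \<eta>:]) n)) differentiable (at \<theta>)"
      by (rule differentiable_compose[of Re, OF bounded_linear_imp_differentiable[OF bounded_linear_Re]
            differentiable_coeff_prod_linear[OF finite_atLeastAtMost gdiff]])
    ultimately show "(\<lambda>\<eta>. inner (IR \<eta>) b) differentiable (at \<theta>)" by (rule differentiable_cong_nhds)
  qed
  thus "IR differentiable (at \<theta>)" .
  define J where "J = jacobian IR (at \<theta>)"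
  have J: "(IR has_derivative (*v) J) (at \<theta>)" using IRdiff by (simp add: J_def jacobian_works)
  have IR\<theta>: "IR \<theta> = \<theta>" using IR by simp
  have IRlim: "(IR \<longlongrightarrow> \<theta>) (nhds \<theta>)"
    using differentiable_imp_continuous_within[OF IRdiff] IR\<theta>
    by (simp add: continuous_at tendsto_nhds_iff)
  have "(\<Prod>l\<in>?L. [:1, - lam l:]) = (\<Prod>l\<in>?L. [:1, - g l \<theta>:])"
    using facIR[OF U(2)] \<theta> IR\<theta> by simp
  also have "\<dots> = (\<Prod>l\<in>?L. [:1, - (if l \<in> S then inverse (lam l) else lam l):])"
    by (intro prod.cong) (use \<Lambda>\<theta> in \<open>auto simp: g_def\<close>)
  finally obtain \<pi> where \<pi>: "bij_betw \<pi> S S" "\<And>l. l \<in> S \<Longrightarrow> lam (\<pi> l) = inverse (lam l)"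
    "\<And>l. l \<notin> S \<Longrightarrow> \<pi> l = l"
    using fixed_inversion_perm[OF S finite_atLeastAtMost inj nz] by blast
  \<comment> \<open>Near \<theta>, the inverted branches at \<eta> and the original branches at
    \<open>IR \<eta>\<close> are roots of the same polynomial; their values at \<theta> show that
    they correspond under \<pi>.\<close>
  have "\<forall>\<^sub>F \<eta> in nhds \<theta>. \<forall>l\<in>?L. g l \<eta> = \<Lambda> (\<pi> l) (IR \<eta>)"
  proof (rule roots_match[OF inj, where h = IR])
    show "\<pi> l \<in> ?L" if "l \<in> ?L" for l
      using bij_betwE[OF \<pi>(1)] \<pi>(3)[of l] that S by (cases "l \<in> S") (blast, simp)
    show "((\<lambda>\<eta>. \<Lambda> l (IR \<eta>)) \<longlongrightarrow> lam l) (nhds \<theta>)" if "l \<in> ?L" for l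
      using isCont_tendsto_compose[OF \<Lambda>isCont[OF that] IRlim] \<Lambda>\<theta>[OF that] by simp
    show "(g l \<longlongrightarrow> lam (\<pi> l)) (nhds \<theta>)" if "l \<in> ?L" for l
    proof -
      have "isCont (g l) \<theta>" by (rule differentiable_imp_continuous_within[OF gdiff[OF that]])
      moreover have "g l \<theta> = lam (\<pi> l)" using \<Lambda>\<theta>[OF that] \<pi>(2,3) by (simp add: g_def)
      ultimately show ?thesis by (simp add: continuous_at tendsto_nhds_iff)
    qed
    show "\<forall>\<^sub>F \<eta> in nhds \<theta>. ma_poly (IR \<eta>) = (\<Prod>l\<in>?L. [:1, - \<Lambda> l (IR \<eta>):]) \<and>
      ma_poly (IR \<eta>) = (\<Prod>l\<in>?L. [:1, - g l \<eta>:])"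
      using evU topological_tendstoD[OF IRlim U]
      by eventually_elim (use fac facIR in blast)
  qed
  hence "\<forall>\<^sub>F \<eta> in nhds \<theta>. IR (IR \<eta>) = \<eta>"
    using evU topological_tendstoD[OF IRlim U]
  proof eventually_elim
    case (elim \<eta>)
    have "ma_poly (IR (IR \<eta>)) = (\<Prod>l\<in>?L - S. [:1, - \<Lambda> l (IR \<eta>):]) * (\<Prod>l\<in>S. [:1, - inverse (\<Lambda> l (IR \<eta>)):])"
      by (rule facIR'[OF elim(3)])
    also have "(\<Prod>l\<in>?L - S. [:1, - \<Lambda> l (IR \<eta>):]) = (\<Prod>l\<in>?L - S. [:1, - \<Lambda> l \<eta>:])"
    proof (rule prod.cong)
      fix l assume "l \<in> ?L - S"
      thus "[:1, - \<Lambda> l (IR \<eta>):] = [:1, - \<Lambda> l \<eta>:]"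
        using bspec[OF elim(1), of l] \<pi>(3)[of l] by (simp add: g_def)
    qed simp
    \<comment> \<open>Reindexing by \<pi> exposes the branches known to be inverses at \<eta>, and
      the second inversion undoes the first.\<close>
    also have "(\<Prod>l\<in>S. [:1, - inverse (\<Lambda> l (IR \<eta>)):]) = (\<Prod>l\<in>S. [:1, - inverse (\<Lambda> (\<pi> l) (IR \<eta>)):])"
      by (rule prod.reindex_bij_betw[OF \<pi>(1), symmetric])
    also have "\<dots> = (\<Prod>l\<in>S. [:1, - \<Lambda> l \<eta>:])"
    proof (rule prod.cong)
      fix l assume "l \<in> S"
      hence "inverse (\<Lambda> l \<eta>) = \<Lambda> (\<pi> l) (IR \<eta>)" using bspec[OF elim(1), of l] S by (auto simp: g_def)
      thus "[:1, - inverse (\<Lambda> (\<pi> l) (IR \<eta>)):] = [:1, - \<Lambda> l \<eta>:]" by (metis inverse_inverse_eq)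
    qed simp
    also have "(\<Prod>l\<in>?L - S. [:1, - \<Lambda> l \<eta>:]) * \<dots> = ma_poly \<eta>"
      using fac[OF elim(2)] prod.subset_diff[OF S, of "\<lambda>l. [:1, - \<Lambda> l \<eta>:]"] by simp
    finally show ?case by (rule ma_poly_inject)
  qed
  hence inv: "\<forall>\<^sub>F \<eta> in at \<theta>. \<eta> = IR (IR \<eta>)"
    by (auto simp: eventually_nhds_conv_at elim: eventually_mono)
  \<comment> \<open>The outer derivative is taken at \<open>IR \<theta> = \<theta>\<close>, so the
    same \<open>J\<close> occurs twice.\<close>
  have "((\<lambda>\<eta>. IR (IR \<eta>)) has_derivative (\<lambda>h. J *v (J *v h))) (at \<theta>)"
    using has_derivative_compose[OF J, of IR "(*v) J"] J IR\<theta> by simp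
  moreover have "((\<lambda>\<eta>. IR (IR \<eta>)) has_derivative (\<lambda>h. h)) (at \<theta>)"
    by (rule has_derivative_transform_eventually[OF has_derivative_ident inv]) (simp_all add: IR\<theta>)
  ultimately have "(\<lambda>h. J *v (J *v h)) = (\<lambda>h. h)" by (rule has_derivative_unique)
  hence JJ: "J ** J = Finite_Cartesian_Product.mat 1"
    unfolding matrix_eq by (simp add: fun_eq_iff flip: matrix_vector_mul_assoc)
  thus "jacobian IR (at \<theta>) ** jacobian IR (at \<theta>) = Finite_Cartesian_Product.mat 1" by (simp only: J_def)
  show "\<mu> = 1 \<or> \<mu> = -1" if "complex_eigenvalue (jacobian IR (at \<theta>)) \<mu>" for \<mu>
    using involution_eigenvalue[OF JJ[unfolded J_def] that] .
  fix X assume lik: "lik_defined X p T k \<theta>"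
  obtain D where D: "(Lbar X p T k has_derivative D) (at \<theta>)"
    using Lbar_differentiable(1)[OF T lik] by (auto simp: differentiable_def)
  interpret D: bounded_linear D using D by (rule has_derivative_bounded_linear)
  \<comment> \<open>The vector representing the linear functional \<open>D\<close> through the inner
    product.\<close>
  define G where "G = (\<Sum>b\<in>Basis. D b *\<^sub>R b)"
  have DG: "D h = inner h G" for h
  proof -
    have "D h = D (\<Sum>b\<in>Basis. inner h b *\<^sub>R b)" by (simp add: euclidean_representation)
    thus ?thesis by (simp add: D.sum D.scale G_def inner_sum_right mult.commute)
  qed
  have GD: "GDERIV (Lbar X p T k) \<theta> :> G" using D by (simp add: gderiv_def flip: DG)
  \<comment> \<open>Nonzero roots are assumed only at \<theta>; continuity extends this to nearby
    points, where the scaling of the autocovariances is applied.\<close>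
  have "\<forall>\<^sub>F \<eta> in nhds \<theta>. \<forall>l\<in>?L. \<Lambda> l \<eta> \<noteq> 0"
  proof (intro eventually_ball_finite ballI)
    fix l assume "l \<in> ?L"
    thus "\<forall>\<^sub>F \<eta> in nhds \<theta>. \<Lambda> l \<eta> \<noteq> 0"
      using \<Lambda>isCont[of l] \<Lambda>nz[of l]
      by (auto simp: continuous_at eventually_nhds_conv_at intro: tendsto_imp_eventually_ne)
  qed simp
  hence "\<forall>\<^sub>F \<eta> in nhds \<theta>. Lbar X p T k (IR \<eta>) = Lbar X p T k \<eta>"
    using evU Lbar_differentiable(2)[OF T lik]
  proof eventually_elim
    case (elim \<eta>)
    obtain c where "c > 0" "\<And>h. acov (IR \<eta>) h = c * acov \<eta> h"
      using acov_root_inversion[OF fac[OF elim(2)] facIR[OF elim(2), unfolded g_def]] elim(1) by blast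
    thus ?case using Lbar_scale[OF T] elim(3) by blast
  qed
  hence eqL: "\<forall>\<^sub>F \<eta> in at \<theta>. Lbar X p T k \<eta> = Lbar X p T k (IR \<eta>)"
    by (auto simp: eventually_nhds_conv_at elim: eventually_mono)
  \<comment> \<open>Since \<open>IR \<theta> = \<theta>\<close>, the chain rule involves the
    derivative of the likelihood at \<theta> itself; local invariance gives \<open>D\<close> as a
    second derivative of the same composition.\<close>
  have "((\<lambda>\<eta>. Lbar X p T k (IR \<eta>)) has_derivative (\<lambda>h. D (J *v h))) (at \<theta>)"
    using has_derivative_compose[OF J, of "Lbar X p T k" D] D IR\<theta> by simp
  moreover have "((\<lambda>\<eta>. Lbar X p T k (IR \<eta>)) has_derivative D) (at \<theta>)"
    by (rule has_derivative_transform_eventually[OF D eqL]) (simp_all add: IR\<theta>)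
  ultimately have "(\<lambda>h. D (J *v h)) = D" by (rule has_derivative_unique)
  hence "inner (J *v h) G = inner h G" for h by (simp add: fun_eq_iff DG)
  hence "inner (G v* J) h = inner G h" for h
    by (simp only: dot_lmul_matrix inner_commute[of G])
  hence GJ: "G v* J = G" by (rule iffD1[OF vector_eq_rdot, OF allI])
  show "\<exists>G. GDERIV (Lbar X p T k) \<theta> :> G \<and> G v* jacobian IR (at \<theta>) = G"
    by (rule exI[of _ G], rule conjI[OF GD GJ[unfolded J_def]])
qed

end
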